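(* Let $\varepsilon > 0$ be fixed. For all real $x \geq 1$ and all integers $q \geq 1$ with $q \leq x$, we have $$\sum_{a \in (\mathbb{Z}/q\mathbb{Z})^{\times}} |E(x;q,a)| \ll x^{\varepsilon} \left( x^{1/4} q^{3/4} + x^{1/2} q^{1/4} \right).$$
   Context: For real $x \geq 1$, an integer $q \geq 1$ with $q \leq x$, and $a \in (\mathbb{Z}/q\mathbb{Z})^{\times}$, let $$S(x;q,a) = \sum_{\substack{1 \leq n \leq x \\ n \equiv a \ (\mathrm{mod}\ q)}} |\mu(n)|,$$ where $\mu$ is the Möbius function, and define $E(x;q,a)$ by $$S(x;q,a) = c_q \frac{x}{q} + E(x;q,a), \qquad c_q = \prod_{p \nmid q} \left( 1 - \frac{1}{p^2} \right),$$ the product being over primes $p$ not dividing $q$. The notation $A \ll B$ means that $|A| \leq C B$ for some constant $C > 0$ depending only on $\varepsilon$ (in particular, independent of $x$ and $q$). *)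

theory Defs
  imports
    "HOL-Analysis.Analysis"
    "HOL-Number_Theory.Number_Theory"
    "HOL-Computational_Algebra.Squarefree"
begin

definition moebius_mu :: "nat \<Rightarrow> int" where
  "moebius_mu n = (if squarefree n then (- 1) ^ card (prime_factors n) else 0)"

(* The residue class a is given by any representative; the units modulo q are represented by
   totatives q, which for q = 1 is {1}. *)
definition sqfree_sum :: "real \<Rightarrow> nat \<Rightarrow> nat \<Rightarrow> real" where
  "sqfree_sum x q a = (\<Sum>n | 1 \<le> n \<and> real n \<le> x \<and> [n = a] (mod q). \<bar>real_of_int (moebius_mu n)\<bar>)"

(* The Euler product is indexed by all naturals, with factor 1 at every index that is not a
   prime or divides q. *)
definition sqfree_density :: "nat \<Rightarrow> real" where
  "sqfree_density q = (\<Prod>p. if prime p \<and> \<not> p dvd q then 1 - 1 / (real p)\<^sup>2 else 1)"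

(* prodinf is a definite description; this shows that the product above does converge. *)
lemma convergent_prod_sqfree_density:
  "convergent_prod (\<lambda>p. if prime p \<and> \<not> p dvd q then 1 - 1 / (real p)\<^sup>2 else 1)"
proof (rule abs_convergent_prod_imp_convergent_prod, rule summable_imp_abs_convergent_prod)
  have "summable (\<lambda>p. 1 / (real p)\<^sup>2)"
    using inverse_power_summable[of 2, where ?'a = real] by (simp add: divide_inverse)
  then show "summable (\<lambda>p. norm ((if prime p \<and> \<not> p dvd q then 1 - 1 / (real p)\<^sup>2 else 1) - 1))"
    by (rule summable_comparison_test'[where N = 0]) auto
qed

definition sqfree_error :: "real \<Rightarrow> nat \<Rightarrow> nat \<Rightarrow> real" where
  "sqfree_error x q a = sqfree_sum x q a - sqfree_density q * (x / real q)"

end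

theory Submission
  imports Defs
begin

text \<open>
  Write \<^term>\<open>\<bar>moebius_mu n\<bar>\<close> as the sum of \<^term>\<open>moebius_mu d\<close> over
  \<^term>\<open>d\<^sup>2 dvd n\<close> and cut at \<open>N = x\<^sup>1\<^sup>/\<^sup>2 q\<^sup>-\<^sup>1\<^sup>/\<^sup>4\<close>. The terms with \<open>d > N\<close> contribute
  \<open>O(x / N)\<close> to the sum over \<open>a\<close> trivially. For \<open>d \<le> N\<close> use Cauchy--Schwarz and Parseval modulo \<open>q\<close>:
  the \<open>k\<close>-th Fourier coefficient is a sum over \<open>d\<close> of geometric sums of size at most
  \<open>min (x / d\<^sup>2) (q / \<parallel>k d\<^sup>2\<parallel>)\<close>. After a dyadic decomposition \<open>d \<sim> P\<close>,
  \<open>\<parallel>k d\<^sup>2\<parallel> \<sim> R\<close>, the second moment over \<open>k\<close> counts solutions of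
  \<open>h e\<^sup>2 \<equiv> h' d\<^sup>2\<close> modulo \<open>q\<close>. Cauchy--Schwarz separates the variables and leaves the
  counts of \<open>h\<^sub>1 h\<^sub>2 \<equiv> h\<^sub>3 h\<^sub>4\<close> and \<open>(d\<^sub>1 d\<^sub>2)\<^sup>2 \<equiv> (d\<^sub>3 d\<^sub>4)\<^sup>2\<close>,
  which the divisor bound controls by \<open>x\<^sup>\<epsilon> R\<^sup>2 (1 + R\<^sup>2 / q)\<close> and \<open>x\<^sup>\<epsilon> P\<^sup>2 (1 + P\<^sup>2 / q)\<close>.
\<close>

section \<open>The divisor bound\<close>

text \<open>Exponential growth beats linear growth: \<open>1 + t * e \<le> exp (t * e)\<close> with
  \<open>t = \<epsilon> * ln 2\<close>. Base 2 serves every prime, as all of them are at least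
  2.\<close>

lemma nat_Suc_le_powr:
  fixes \<epsilon> :: real
  assumes "\<epsilon> > 0"
  obtains C where "C \<ge> 1" "\<And>e::nat. real e + 1 \<le> C * 2 powr (real e * \<epsilon>)"
proof
  define C where "C = 1 + 1 / (\<epsilon> * ln 2)"
  have l: "\<epsilon> * ln 2 > 0" using assms by simp
  then show "C \<ge> 1" by (simp add: C_def)
  fix e :: nat
  define t where "t = \<epsilon> * ln 2"
  have t: "t > 0" using l by (simp add: t_def)
  have "real e + 1 \<le> (1 + 1 / t) * (1 + t * real e)"
    using t by (simp add: field_simps)
  also have "\<dots> \<le> (1 + 1 / t) * exp (t * real e)"
    using t exp_ge_add_one_self[of "t * real e"] by (intro mult_left_mono) auto
  also have "exp (t * real e) = 2 powr (real e * \<epsilon>)"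
    by (simp add: powr_def t_def mult_ac)
  finally show "real e + 1 \<le> C * 2 powr (real e * \<epsilon>)" by (simp add: C_def t_def)
qed

lemma card_divisors_prime_power_mult_le:
  fixes p m :: nat
  assumes "prime p" "m > 0"
  shows "card {d. d dvd p ^ e * m} \<le> (e + 1) * card {d. d dvd m}"
proof -
  have fin: "finite ({0..e} \<times> {d. d dvd m})" using assms by simp
  have "{d. d dvd p ^ e * m} \<subseteq> (\<lambda>(i, d). p ^ i * d) ` ({0..e} \<times> {d. d dvd m})"
  proof
    fix d assume "d \<in> {d. d dvd p ^ e * m}"
    then obtain a b where ab: "d = a * b" "a dvd p ^ e" "b dvd m"
      by (auto dest: division_decomp)
    moreover obtain i where "i \<le> e" "a = p ^ i"
      using ab(2) assms(1) by (auto simp: divides_primepow_nat)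
    ultimately show "d \<in> (\<lambda>(i, d). p ^ i * d) ` ({0..e} \<times> {d. d dvd m})"
      by (auto simp: image_iff)
  qed
  then have "card {d. d dvd p ^ e * m} \<le> card ({0..e} \<times> {d. d dvd m})"
    by (rule surj_card_le[OF fin])
  then show ?thesis by (simp add: card_cartesian_product)
qed

text \<open>Splitting off the full power \<open>p ^ e\<close> of a prime costs a factor
  \<open>e + 1\<close>. If \<open>p powr \<epsilon> \<ge> 2\<close>, then
  \<open>e + 1 \<le> 2 ^ e \<le> p powr (e * \<epsilon>)\<close> absorbs it; each of the finitely
  many smaller primes costs one factor \<open>K\<close>, whence the constant
  \<open>K ^ card Q\<close>.\<close>

lemma card_divisors_le_powr:
  fixes \<epsilon> :: real
  assumes \<epsilon>: "\<epsilon> > 0"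
  obtains C where "C \<ge> 1" "\<And>n::nat. n > 0 \<Longrightarrow> real (card {d. d dvd n}) \<le> C * real n powr \<epsilon>"
proof -
  obtain K where K: "K \<ge> 1" "\<And>e::nat. real e + 1 \<le> K * 2 powr (real e * \<epsilon>)"
    using nat_Suc_le_powr[OF \<epsilon>] by blast
  define Q where "Q = {p::nat. real p < 2 powr (1 / \<epsilon>)}"
  have "Q \<subseteq> {..nat \<lceil>2 powr (1 / \<epsilon>)\<rceil>}" by (auto simp: Q_def le_nat_iff) linarith
  then have finQ: "finite Q" by (rule finite_subset) simp
  \<comment> \<open>The induction carries a finite set \<open>S\<close> containing the small primes
    of \<open>n\<close>: a small prime that is stripped also leaves \<open>S\<close>, so the
    exponent of \<open>K\<close> drops by exactly one.\<close>
  have main: "real (card {d. d dvd n}) \<le> K ^ card S * real n powr \<epsilon>"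
    if "n > 0" "finite S" "prime_factors n \<inter> Q \<subseteq> S" for n :: nat and S
    using that
  proof (induction n arbitrary: S rule: less_induct)
    case (less n)
    show ?case
    proof (cases "n = 1")
      case True
      then show ?thesis using K(1) by (simp add: one_le_power)
    next
      case False
      then obtain p where p: "prime p" "p dvd n" using prime_factor_nat by blast
      define e where "e = multiplicity p n"
      have "n \<noteq> 0" "\<not> is_unit p" using less.prems(1) p by auto
      then obtain m where m: "n = p ^ e * m" "\<not> p dvd m"
        unfolding e_def by (rule multiplicity_decompose')
      have m0: "m > 0" using m less.prems(1) by (cases m) auto
      have e0: "e > 0" using p m by (cases e) auto
      have p2: "p \<ge> 2" using p by (simp add: prime_ge_2_nat)
      have mn: "m < n" using m m0 e0 p2 one_less_power[of p e] by simp
      have pf: "prime_factors m \<subseteq> prime_factors n - {p}"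
        using m m0 less.prems(1) by (auto simp: prime_factors_dvd)
      have step: "real (card {d. d dvd n}) \<le> (real e + 1) * real (card {d. d dvd m})"
        using of_nat_mono[OF card_divisors_prime_power_mult_le[OF p(1) m0, of e], where 'a = real]
        unfolding m(1) by (simp add: algebra_simps)
      have pn: "real n powr \<epsilon> = real p powr (real e * \<epsilon>) * real m powr \<epsilon>"
        using m(1) p2 by (simp add: powr_mult powr_powr flip: powr_realpow)
      show ?thesis
      proof (cases "p \<in> Q")
        case True
        then have pS: "p \<in> S" using less.prems p by (auto simp: prime_factors_dvd)
        have IH: "real (card {d. d dvd m}) \<le> K ^ card (S - {p}) * real m powr \<epsilon>"
          using less.prems pf by (intro less.IH[OF mn m0]) auto
        have "(real e + 1) \<le> K * real p powr (real e * \<epsilon>)"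
        proof -
          have "K * 2 powr (real e * \<epsilon>) \<le> K * real p powr (real e * \<epsilon>)"
            using K(1) p2 \<epsilon> by (intro mult_left_mono powr_mono2) auto
          then show ?thesis using K(2)[of e] by linarith
        qed
        then have "(real e + 1) * real (card {d. d dvd m}) \<le>
          (K * real p powr (real e * \<epsilon>)) * (K ^ card (S - {p}) * real m powr \<epsilon>)"
          using IH K(1) by (intro mult_mono) auto
        also have "\<dots> = K ^ Suc (card (S - {p})) * real n powr \<epsilon>" by (simp add: pn)
        also have "Suc (card (S - {p})) = card S" using pS less.prems by (metis card_Suc_Diff1)
        finally show ?thesis using step by linarith
      next
        case False
        then have "2 powr (1 / \<epsilon>) \<le> real p" by (simp add: Q_def)
        then have "(2 powr (1 / \<epsilon>)) powr (real e * \<epsilon>) \<le> real p powr (real e * \<epsilon>)"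
          using \<epsilon> by (intro powr_mono2) auto
        then have "2 ^ e \<le> real p powr (real e * \<epsilon>)"
          using \<epsilon> by (simp add: powr_powr powr_realpow)
        moreover have "real e + 1 \<le> 2 ^ e"
          using less_exp[of e] by (metis Suc_leI of_nat_Suc of_nat_le_iff of_nat_numeral of_nat_power add.commute)
        ultimately have "real e + 1 \<le> real p powr (real e * \<epsilon>)" by linarith
        moreover have IH: "real (card {d. d dvd m}) \<le> K ^ card S * real m powr \<epsilon>"
          using less.prems pf by (intro less.IH[OF mn m0]) auto
        ultimately have "(real e + 1) * real (card {d. d dvd m}) \<le>
          real p powr (real e * \<epsilon>) * (K ^ card S * real m powr \<epsilon>)"
          by (intro mult_mono) auto
        then show ?thesis using step by (simp add: pn mult_ac)
      qed
    qed
  qed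
  show ?thesis
  proof
    show "K ^ card Q \<ge> 1" using K(1) by (simp add: one_le_power)
    show "real (card {d. d dvd n}) \<le> K ^ card Q * real n powr \<epsilon>" if "n > 0" for n :: nat
      using main[OF that finQ] by simp
  qed
qed

section \<open>Multiplicative congruences\<close>

text \<open>On a single residue class modulo \<open>l\<close> the quotient \<open>a div l\<close>
  determines \<open>a\<close>, and it takes at most \<open>N div l + 1\<close> values.\<close>

lemma card_le_of_pairwise_cong:
  fixes l N :: nat
  assumes "l > 0" "A \<subseteq> {1..N}" "\<And>a b. a \<in> A \<Longrightarrow> b \<in> A \<Longrightarrow> [a = b] (mod l)"
  shows "real (card A) \<le> real N / real l + 1"
proof -
  have "inj_on (\<lambda>a. a div l) A"
    using assms(3) by (intro inj_onI) (metis cong_def div_mult_mod_eq)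
  moreover have "(\<lambda>a. a div l) ` A \<subseteq> {0..N div l}"
    using assms(2) by (auto intro!: div_le_mono)
  ultimately have "card A \<le> card {0..N div l}" by (intro card_inj_on_le) auto
  then have "real (card A) \<le> real (N div l) + 1" by simp
  also have "real (N div l) \<le> real N / real l" by (rule of_nat_div_le_of_nat)
  finally show ?thesis by simp
qed

lemma card_Sigma_le:
  fixes c d :: real
  assumes "finite A" "\<And>a. a \<in> A \<Longrightarrow> finite (B a)" "real (card A) \<le> c"
    "\<And>a. a \<in> A \<Longrightarrow> real (card (B a)) \<le> d" "d \<ge> 0"
  shows "real (card (Sigma A B)) \<le> c * d"
proof -
  have "real (card (Sigma A B)) = (\<Sum>a\<in>A. real (card (B a)))"
    using assms by (simp add: card_SigmaI)
  also have "\<dots> \<le> (\<Sum>a\<in>A. d)" by (intro sum_mono assms)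
  also have "\<dots> = real (card A) * d" by simp
  also have "\<dots> \<le> c * d" using assms by (intro mult_right_mono) auto
  finally show ?thesis .
qed

text \<open>A quadruple is determined by \<^term>\<open>(a, b)\<close>, the value of \<^term>\<open>c * d\<close> and its divisor \<^term>\<open>c\<close>.\<close>
lemma card_quadruples_le:
  fixes N :: nat and R :: "nat \<Rightarrow> nat \<Rightarrow> bool" and X :: "nat set"
  assumes X: "X \<subseteq> {1..N}"
    and R: "\<And>n. real (card {m \<in> {1..N\<^sup>2}. R n m}) \<le> K"
    and T: "\<And>n. 1 \<le> n \<Longrightarrow> n \<le> N\<^sup>2 \<Longrightarrow> real (card {d. d dvd n}) \<le> T"
    and T0: "T \<ge> 0"
  shows "real (card {((a, b), (c, d)). (a, b) \<in> X \<times> X \<and> (c, d) \<in> X \<times> X \<and> R (a * b) (c * d)})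
           \<le> (real N)\<^sup>2 * (K * T)"
proof -
  define S where "S = {((a, b), (c, d)). (a, b) \<in> X \<times> X \<and> (c, d) \<in> X \<times> X \<and> R (a * b) (c * d)}"
  define M where "M = (\<lambda>(a, b). SIGMA m : {m \<in> {1..N\<^sup>2}. R (a * b) m}. {d. d dvd m})"
  define f where "f = (\<lambda>((a, b), (c, d)). ((a, b), (c * d, c)) :: (nat \<times> nat) \<times> (nat \<times> nat))"
  have finX: "finite X" using X finite_subset by blast
  have cX: "card X \<le> N" using X card_mono[of "{1..N}" X] by simp
  have finM: "finite (M z)" for z
    by (cases z) (auto simp: M_def)
  have K0: "K \<ge> 0" using R[of 0] by (meson of_nat_0_le_iff order_trans)
  \<comment> \<open>\<open>d\<close> is recovered from \<open>c * d\<close> and \<open>c\<close>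
    because \<open>X\<close> excludes 0.\<close>
  have "inj_on f S"
    using X by (fastforce simp: f_def S_def inj_on_def)
  moreover have "f ` S \<subseteq> Sigma (X \<times> X) M"
  proof -
    have "1 \<le> c * d \<and> c * d \<le> N\<^sup>2" if "c \<in> X" "d \<in> X" for c d
      using that X by (force simp: power2_eq_square intro!: mult_le_mono)
    then show ?thesis by (fastforce simp: f_def S_def M_def)
  qed
  ultimately have "card S \<le> card (Sigma (X \<times> X) M)"
    using finX finM by (intro card_inj_on_le) auto
  also have "real \<dots> \<le> (real N)\<^sup>2 * (K * T)"
  proof (rule card_Sigma_le)
    show "real (card (X \<times> X)) \<le> (real N)\<^sup>2"
      using cX by (simp add: card_cartesian_product power2_eq_square mult_mono)
    fix z assume "z \<in> X \<times> X"
    show "real (card (M z)) \<le> K * T"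
    proof (cases z)
      case (Pair a b)
      have "real (card (SIGMA m : {m \<in> {1..N\<^sup>2}. R (a * b) m}. {d. d dvd m})) \<le> K * T"
        using T T0 by (intro card_Sigma_le R) auto
      then show ?thesis by (simp only: M_def Pair case_prod_conv)
    qed
  qed (use finX finM K0 T0 in auto)
  finally show ?thesis by (simp add: S_def)
qed

lemma card_cong_le:
  fixes N q n :: nat
  assumes "q > 0"
  shows "real (card {m \<in> {1..N}. [n = m] (mod q)}) \<le> real N / real q + 1"
  using assms by (intro card_le_of_pairwise_cong) (auto intro: cong_trans cong_sym)

text \<open>With \<^term>\<open>g = gcd (m - n) q\<close> the congruence gives \<^term>\<open>m\<close> modulo \<^term>\<open>g\<close> and modulo
  \<^term>\<open>q div g\<close>, and the gcd of these two moduli divides 2.\<close>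
lemma card_square_cong_le:
  fixes N q n :: nat
  assumes q: "q > 0" and n: "coprime n q"
  shows "real (card {m \<in> {1..N}. [n\<^sup>2 = m\<^sup>2] (mod q)})
           \<le> real (card {d. d dvd q}) * (2 * real N / real q + 1)"
proof -
  define M where "M = (\<lambda>g. {m \<in> {1..N}. int g dvd int m - int n \<and> int (q div g) dvd int m + int n})"
  have "{m \<in> {1..N}. [n\<^sup>2 = m\<^sup>2] (mod q)} \<subseteq> (\<Union>g\<in>{d. d dvd q}. M g)"
  proof
    fix m assume m: "m \<in> {m \<in> {1..N}. [n\<^sup>2 = m\<^sup>2] (mod q)}"
    then have "[int (m\<^sup>2) = int (n\<^sup>2)] (mod int q)" unfolding cong_int_iff by (simp add: cong_sym)
    then have "int q dvd (int m)\<^sup>2 - (int n)\<^sup>2" by (simp add: cong_iff_dvd_diff)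
    then have dv: "int q dvd (int m - int n) * (int m + int n)"
      by (simp add: power2_eq_square algebra_simps)
    define g where "g = nat (gcd (int m - int n) (int q))"
    have ig: "int g = gcd (int m - int n) (int q)" by (simp add: g_def)
    have gq: "g dvd q" by (metis gcd_dvd2 ig int_dvd_int_iff)
    have g0: "g > 0" using gq q by (auto intro: Nat.gr0I)
    obtain w where w: "int m - int n = int g * w" by (metis dvd_def gcd_dvd1 ig)
    obtain v where v: "q = g * v" using gq by (auto simp: dvd_def)
    \<comment> \<open>Once the whole gcd \<open>g\<close> is taken out of \<open>m - n\<close>, the
      cofactor \<open>w\<close> shares no factor with \<open>v\<close>, so all of \<open>v\<close>
      must divide \<open>m + n\<close>.\<close>
    have "coprime w (int v)"
    proof -
      have "int g * gcd w (int v) = gcd (int g * w) (int g * int v)"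
        using gcd_mult_distrib_int[of "int g" w "int v"] by simp
      also have "\<dots> = int g" using ig w v by simp
      finally show ?thesis using g0 by (simp add: coprime_iff_gcd_eq_1)
    qed
    moreover have "int g * int v dvd int g * (w * (int m + int n))" using dv v w by (simp add: mult.assoc)
    then have "int v dvd w * (int m + int n)" using g0 by simp
    ultimately have "int v dvd int m + int n"
      by (simp add: coprime_dvd_mult_right_iff coprime_commute)
    moreover have "q div g = v" using v g0 by simp
    ultimately show "m \<in> (\<Union>g\<in>{d. d dvd q}. M g)"
      using m w gq by (auto simp: M_def intro!: exI[of _ g])
  qed
  moreover have finM: "finite (M g)" for g by (auto simp: M_def)
  ultimately have "card {m \<in> {1..N}. [n\<^sup>2 = m\<^sup>2] (mod q)} \<le> card (\<Union>g\<in>{d. d dvd q}. M g)"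
    using q by (intro card_mono) auto
  also have "\<dots> \<le> (\<Sum>g\<in>{d. d dvd q}. card (M g))" using q by (intro card_UN_le) auto
  finally have "real (card {m \<in> {1..N}. [n\<^sup>2 = m\<^sup>2] (mod q)}) \<le> (\<Sum>g\<in>{d. d dvd q}. real (card (M g)))"
    by (simp flip: of_nat_sum)
  also have "\<dots> \<le> (\<Sum>g\<in>{d. d dvd q}. 2 * real N / real q + 1)"
  proof (rule sum_mono)
    fix g assume "g \<in> {d. d dvd q}"
    then obtain v where v: "q = g * v" by (auto simp: dvd_def)
    have g0: "g > 0" "v > 0" using v q by auto
    show "real (card (M g)) \<le> 2 * real N / real q + 1"
    proof (cases "M g = {}")
      case True
      then show ?thesis by simp
    next
      case False
      then obtain m where m: "int g dvd int m - int n" "int v dvd int m + int n"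
        using v g0 by (auto simp: M_def)
      \<comment> \<open>A common divisor of \<open>g\<close> and \<open>v\<close> divides
        \<open>2 * n\<close>, and as a divisor of \<open>q\<close> it is coprime to
        \<open>n\<close>. Hence it divides 2, and \<open>q = gcd g v * lcm g v\<close> is at most
        twice the lcm.\<close>
      have "int (gcd g v) dvd (int m + int n) - (int m - int n)"
        by (rule dvd_diff; rule dvd_trans[OF _ m(2)] dvd_trans[OF _ m(1)]) (simp_all only: int_dvd_int_iff gcd_dvd1 gcd_dvd2)
      also have "(int m + int n) - (int m - int n) = int (2 * n)" by simp
      finally have "gcd g v dvd 2 * n" by (simp only: int_dvd_int_iff)
      moreover have "coprime (gcd g v) n"
        using n v by (metis coprime_commute coprime_divisors dvd_refl dvd_triv_left gcd_dvd1 dvd_trans)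
      ultimately have "gcd g v dvd 2" by (simp add: coprime_dvd_mult_left_iff)
      then have "gcd g v \<le> 2" by (simp add: dvd_imp_le)
      then have l: "q \<le> 2 * lcm g v"
        using v prod_gcd_lcm_nat[of g v] by (metis mult_le_mono1)
      have l0: "lcm g v > 0" using g0 by (simp add: lcm_pos_nat)
      have "real (card (M g)) \<le> real N / real (lcm g v) + 1"
      proof (rule card_le_of_pairwise_cong[OF l0])
        show "M g \<subseteq> {1..N}" by (auto simp: M_def)
        fix a b assume ab: "a \<in> M g" "b \<in> M g"
        have vv: "q div g = v" using v g0 by simp
        have "int g dvd (int a - int n) - (int b - int n)"
          by (rule dvd_diff) (use ab in \<open>auto simp: M_def\<close>)
        moreover have "int v dvd (int a + int n) - (int b + int n)"
          by (rule dvd_diff) (use ab in \<open>auto simp: M_def vv\<close>)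
        ultimately have "lcm (int g) (int v) dvd int a - int b" by (intro lcm_least) simp_all
        then have "[int a = int b] (mod int (lcm g v))" by (simp add: cong_iff_dvd_diff lcm_int_int_eq)
        then show "[a = b] (mod lcm g v)" by (simp add: cong_int_iff)
      qed
      also have "real N / real (lcm g v) \<le> 2 * real N / real q"
      proof -
        have "real q \<le> 2 * real (lcm g v)" using of_nat_mono[OF l, where 'a = real] by simp
        then have "real N * real q \<le> real N * (2 * real (lcm g v))" by (intro mult_left_mono) auto
        then show ?thesis using q l0 by (simp add: field_simps)
      qed
      finally show ?thesis by simp
    qed
  qed
  also have "\<dots> = real (card {d. d dvd q}) * (2 * real N / real q + 1)" by simp
  finally show ?thesis .
qed

section \<open>Separation of variables in ratio equations\<close>

lemma card_fibre_product:
  assumes "finite U" "finite V" "finite T" "f ` U \<subseteq> T"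
  shows "card {(u, v). u \<in> U \<and> v \<in> V \<and> f u = g v}
           = (\<Sum>t\<in>T. card {u \<in> U. f u = t} * card {v \<in> V. g v = t})"
proof -
  have "{(u, v). u \<in> U \<and> v \<in> V \<and> f u = g v}
      = (\<Union>t\<in>T. {u \<in> U. f u = t} \<times> {v \<in> V. g v = t})"
    using assms by auto
  also have "card \<dots> = (\<Sum>t\<in>T. card ({u \<in> U. f u = t} \<times> {v \<in> V. g v = t}))"
    using assms by (intro card_UN_disjoint) auto
  finally show ?thesis by (simp add: card_cartesian_product)
qed

text \<open>Grouped by the common value \<open>t\<close>, the three counts become sums of products
  of fibre sizes. \<open>T\<close> contains both images, so that all three sums run over the same
  index set.\<close>

lemma card_fibre_product_Cauchy_Schwarz:
  assumes U: "finite U" and V: "finite V"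
  shows "(real (card {(u, v). u \<in> U \<and> v \<in> V \<and> f u = g v}))\<^sup>2
      \<le> real (card {(u, v). u \<in> U \<and> v \<in> U \<and> f u = f v}) * real (card {(u, v). u \<in> V \<and> v \<in> V \<and> g u = g v})"
proof -
  define T where "T = f ` U \<union> g ` V"
  have T: "finite T" "f ` U \<subseteq> T" "g ` V \<subseteq> T" using U V by (auto simp: T_def)
  show ?thesis
    unfolding card_fibre_product[OF U V T(1,2)] card_fibre_product[OF U U T(1,2)]
      card_fibre_product[OF V V T(1,3)]
    using Cauchy_Schwarz_ineq_sum[of "\<lambda>t. real (card {u \<in> U. f u = t})" "\<lambda>t. real (card {v \<in> V. g v = t})" T]
    by (simp add: power2_eq_square)
qed

text \<open>\<open>b'\<close> and \<open>d'\<close> are inverses of \<open>b\<close> and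
  \<open>d\<close>, so this is cross-multiplication for the fractions \<open>a / b\<close> and
  \<open>c / d\<close> modulo \<open>q\<close>.\<close>

lemma cong_fractions_iff:
  fixes a b c d b' d' q :: nat
  assumes b: "[b * b' = 1] (mod q)" and d: "[d * d' = 1] (mod q)"
  shows "[a * b' = c * d'] (mod q) \<longleftrightarrow> [a * d = c * b] (mod q)"
proof
  assume *: "[a * b' = c * d'] (mod q)"
  have "[a * d * 1 = a * d * (b * b')] (mod q)" by (intro cong_mult[OF cong_refl cong_sym[OF b]])
  also have "a * d * (b * b') = a * b' * (b * d)" by (simp add: mult_ac)
  also have "[a * b' * (b * d) = c * d' * (b * d)] (mod q)" by (rule cong_mult[OF * cong_refl])
  also have "c * d' * (b * d) = c * b * (d * d')" by (simp add: mult_ac)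
  also have "[c * b * (d * d') = c * b * 1] (mod q)" by (rule cong_mult[OF cong_refl d])
  finally show "[a * d = c * b] (mod q)" by simp
next
  assume *: "[a * d = c * b] (mod q)"
  have "[a * b' * 1 = a * b' * (d * d')] (mod q)" by (intro cong_mult[OF cong_refl cong_sym[OF d]])
  also have "a * b' * (d * d') = a * d * (b' * d')" by (simp add: mult_ac)
  also have "[a * d * (b' * d') = c * b * (b' * d')] (mod q)" by (rule cong_mult[OF * cong_refl])
  also have "c * b * (b' * d') = c * d' * (b * b')" by (simp add: mult_ac)
  also have "[c * d' * (b * b') = c * d' * 1] (mod q)" by (rule cong_mult[OF cong_refl b])
  finally show "[a * b' = c * d'] (mod q)" by simp
qed

text \<open>For \<^term>\<open>h = k * d\<^sup>2\<close> and \<^term>\<open>h' = k * e\<^sup>2\<close> the ratios \<^term>\<open>h / h'\<close> and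
  \<^term>\<open>d\<^sup>2 / e\<^sup>2\<close> agree modulo \<^term>\<open>q\<close>. Cauchy--Schwarz over the value of
  the ratio separates the \<^term>\<open>h\<close>-variables from the \<^term>\<open>d\<close>-variables.\<close>
lemma card_small_multiples_le:
  fixes q N H :: nat and D :: "nat set" and T :: real
  assumes q: "q > 1" and D: "D \<subseteq> {1..N}" "\<And>d. d \<in> D \<Longrightarrow> coprime d q"
    and T: "T \<ge> 1" "\<And>n. 1 \<le> n \<Longrightarrow> n \<le> H\<^sup>2 \<or> n \<le> N\<^sup>2 \<or> n \<le> q \<Longrightarrow> real (card {d. d dvd n}) \<le> T"
  shows "real (card {(k, d, e). k \<in> totatives q \<and> (d \<in> D \<and> k * d\<^sup>2 mod q \<le> H) \<and> e \<in> D \<and> k * e\<^sup>2 mod q \<le> H})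
     \<le> T\<^sup>2 * (real H * (1 + real H / sqrt (real q))) * (real N * (1 + 2 * real N / sqrt (real q)))"
proof -
  define S where "S = {(k, d, e). k \<in> totatives q \<and> (d \<in> D \<and> k * d\<^sup>2 mod q \<le> H) \<and> e \<in> D \<and> k * e\<^sup>2 mod q \<le> H}"
  \<comment> \<open>The residues \<open>k * d\<^sup>2 mod q\<close> land here: they are units modulo
    \<open>q\<close>, and nonzero because \<open>q > 1\<close>.\<close>
  define X where "X = {h \<in> {1..H}. coprime h q}"
  have "\<exists>v. \<forall>n. coprime n q \<longrightarrow> [n * v n = 1] (mod q)"
    by (rule choice) (use cong_solve_coprime_nat in auto)
  then obtain v where v: "\<And>n. coprime n q \<Longrightarrow> [n * v n = 1] (mod q)" by blast
  \<comment> \<open>With \<open>v\<close> choosing inverses modulo \<open>q\<close>,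
    \<open>f\<close> is the ratio \<open>h / h'\<close> and \<open>g\<close> is the ratio
    \<open>d\<^sup>2 / e\<^sup>2\<close>.\<close>
  define f where "f = (\<lambda>(h, h'). h * v h' mod q)"
  define g where "g = (\<lambda>(d, e). d\<^sup>2 * (v e)\<^sup>2 mod q)"
  have v2: "[n\<^sup>2 * (v n)\<^sup>2 = 1] (mod q)" if "coprime n q" for n
    using cong_pow[OF v[OF that], of 2] by (simp add: power_mult_distrib)
  have fin: "finite X" "finite D" using D(1) by (auto simp: X_def finite_subset)
  have X: "X \<subseteq> {1..H}" "\<And>h. h \<in> X \<Longrightarrow> coprime h q" by (auto simp: X_def)
  have fg: "f (h, h') = g (d, e) \<longleftrightarrow> [h * e\<^sup>2 = d\<^sup>2 * h'] (mod q)" if "h' \<in> X" "e \<in> D" for h h' d e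
    using cong_fractions_iff[OF v[OF X(2)[OF that(1)]] v2[OF D(2)[OF that(2)]], of h "d\<^sup>2"]
    by (simp add: f_def g_def cong_def)
  have ff: "f (h, h') = f (d, e) \<longleftrightarrow> [h * e = d * h'] (mod q)" if "h' \<in> X" "e \<in> X" for h h' d e
    using cong_fractions_iff[OF v[OF X(2)[OF that(1)]] v[OF X(2)[OF that(2)]], of h d]
    by (simp add: f_def cong_def)
  have gg: "g (h, h') = g (d, e) \<longleftrightarrow> [(h * e)\<^sup>2 = (d * h')\<^sup>2] (mod q)" if "h' \<in> D" "e \<in> D" for h h' d e
    using cong_fractions_iff[OF v2[OF D(2)[OF that(1)]] v2[OF D(2)[OF that(2)]], of "h\<^sup>2" "d\<^sup>2"]
    by (simp add: g_def cong_def power_mult_distrib)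

  \<comment> \<open>\<open>F\<close> forgets \<open>k\<close>, but \<open>k\<close> is recovered
    from \<open>k * d\<^sup>2 mod q\<close>, since \<open>d\<^sup>2\<close> is a unit and
    \<open>k < q\<close>.\<close>
  define F where "F = (\<lambda>(k, d, e). ((k * d\<^sup>2 mod q, k * e\<^sup>2 mod q), (d, e :: nat)))"
  have injF: "inj_on F S"
  proof (rule inj_onI)
    fix y z assume yz: "y \<in> S" "z \<in> S" "F y = F z"
    obtain k d e k' d' e' where kde: "y = (k, d, e)" "z = (k', d', e')" by (metis prod_cases3)
    note * = yz[unfolded kde]
    then have eq: "d = d'" "e = e'" "[k * d\<^sup>2 = k' * d\<^sup>2] (mod q)" by (auto simp: F_def cong_def)
    have "coprime (d\<^sup>2) q" using * D by (auto simp: S_def)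
    then have "[k = k'] (mod q)" using eq(3) by (simp add: cong_mult_rcancel_nat)
    moreover have "k < q" "k' < q" using * q by (auto simp: S_def totatives_less)
    ultimately show "y = z" using eq by (simp add: kde cong_less_modulus_unique_nat)
  qed
  have hX: "k * d\<^sup>2 mod q \<in> X" if "k \<in> totatives q" "d \<in> D" "k * d\<^sup>2 mod q \<le> H" for k d
  proof -
    have "coprime (k * d\<^sup>2 mod q) q" using that D(2) q by (simp add: in_totatives_iff)
    moreover from this have "k * d\<^sup>2 mod q \<noteq> 0" using q by (intro notI) simp
    ultimately show ?thesis using that by (simp add: X_def)
  qed
  have "F ` S \<subseteq> {(u, w). u \<in> X \<times> X \<and> w \<in> D \<times> D \<and> f u = g w}"
  proof safe
    fix k d e h h' d' e' assume S: "(k, d, e) \<in> S" and F: "((h, h'), (d', e')) = F (k, d, e)"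
    then have e: "h = k * d\<^sup>2 mod q" "h' = k * e\<^sup>2 mod q" "d' = d" "e' = e" by (auto simp: F_def)
    show m: "h \<in> X" "h' \<in> X" "d' \<in> D" "e' \<in> D" using S e hX by (auto simp: S_def)
    have "[h * e\<^sup>2 = (k * d\<^sup>2) * e\<^sup>2] (mod q)" unfolding e by (simp add: cong_def mod_mult_left_eq)
    also have "(k * d\<^sup>2) * e\<^sup>2 = d\<^sup>2 * (k * e\<^sup>2)" by (simp add: mult_ac)
    also have "[d\<^sup>2 * (k * e\<^sup>2) = d\<^sup>2 * h'] (mod q)" unfolding e by (simp add: cong_def mod_mult_right_eq)
    finally have "[h * e\<^sup>2 = d\<^sup>2 * h'] (mod q)" .
    then show "f (h, h') = g (d', e')" using fg m e by simp
  qed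
  moreover have "finite {(u, w). u \<in> X \<times> X \<and> w \<in> D \<times> D \<and> f u = g w}"
    by (rule finite_subset[of _ "(X \<times> X) \<times> (D \<times> D)"]) (use fin in auto)
  ultimately have cS: "card S \<le> card {(u, w). u \<in> X \<times> X \<and> w \<in> D \<times> D \<and> f u = g w}"
    using injF by (intro card_inj_on_le)
  define A where "A = real (card {(u, w). u \<in> X \<times> X \<and> w \<in> X \<times> X \<and> f u = f w})"
  define B where "B = real (card {(u, w). u \<in> D \<times> D \<and> w \<in> D \<times> D \<and> g u = g w})"
  have CS: "(real (card S))\<^sup>2 \<le> A * B"
  proof -
    have "(real (card S))\<^sup>2 \<le> (real (card {(u, w). u \<in> X \<times> X \<and> w \<in> D \<times> D \<and> f u = g w}))\<^sup>2"
      using cS by (intro power_mono) auto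
    also have "\<dots> \<le> A * B"
      unfolding A_def B_def using fin by (intro card_fibre_product_Cauchy_Schwarz) auto
    finally show ?thesis .
  qed
  \<comment> \<open>Swapping the second entries turns an equation of ratios,
    \<open>a / b = c / d\<close>, into one of products, \<open>a * d = c * b\<close>, which is the
    shape counted by \<open>card_quadruples_le\<close>.\<close>
  define \<sigma> where "\<sigma> = (\<lambda>((a, b), (c, d)). ((a, d), (c, b)) :: (nat \<times> nat) \<times> (nat \<times> nat))"
  have inj\<sigma>: "inj \<sigma>" by (auto simp: \<sigma>_def inj_on_def)
  have A: "A \<le> (real H)\<^sup>2 * ((real (H\<^sup>2) / real q + 1) * T)"
  proof -
    have "card {(u, w). u \<in> X \<times> X \<and> w \<in> X \<times> X \<and> f u = f w}
      \<le> card {((a, b), (c, d)). (a, b) \<in> X \<times> X \<and> (c, d) \<in> X \<times> X \<and> [a * b = c * d] (mod q)}"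
    proof (rule card_inj_on_le[of \<sigma>])
      show "finite {((a, b), (c, d)). (a, b) \<in> X \<times> X \<and> (c, d) \<in> X \<times> X \<and> [a * b = c * d] (mod q)}"
        by (rule finite_subset[of _ "(X \<times> X) \<times> (X \<times> X)"]) (use fin in auto)
    qed (use inj\<sigma> ff in \<open>auto simp: inj_on_def \<sigma>_def\<close>)
    also have "real \<dots> \<le> (real H)\<^sup>2 * ((real (H\<^sup>2) / real q + 1) * T)"
      using T q by (intro card_quadruples_le[OF X(1)] card_cong_le) auto
    finally show ?thesis by (simp add: A_def)
  qed
  have B: "B \<le> (real N)\<^sup>2 * (T * (2 * real (N\<^sup>2) / real q + 1) * T)"
  proof -
    \<comment> \<open>Coprimality is built into \<open>R\<close> because
      \<open>card_quadruples_le\<close> asks for a bound uniform in \<open>n\<close>; for the other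
      \<open>n\<close> the set is empty.\<close>
    define R where "R = (\<lambda>n m. coprime n q \<and> [n\<^sup>2 = m\<^sup>2] (mod q))"
    have "card {(u, w). u \<in> D \<times> D \<and> w \<in> D \<times> D \<and> g u = g w}
      \<le> card {((a, b), (c, d)). (a, b) \<in> D \<times> D \<and> (c, d) \<in> D \<times> D \<and> R (a * b) (c * d)}"
    proof (rule card_inj_on_le[of \<sigma>])
      show "finite {((a, b), (c, d)). (a, b) \<in> D \<times> D \<and> (c, d) \<in> D \<times> D \<and> R (a * b) (c * d)}"
        by (rule finite_subset[of _ "(D \<times> D) \<times> (D \<times> D)"]) (use fin in auto)
    qed (use inj\<sigma> gg D(2) in \<open>auto simp: inj_on_def \<sigma>_def R_def\<close>)
    also have "real \<dots> \<le> (real N)\<^sup>2 * (T * (2 * real (N\<^sup>2) / real q + 1) * T)"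
    proof (rule card_quadruples_le[OF D(1)])
      show "real (card {m \<in> {1..N\<^sup>2}. R n m}) \<le> T * (2 * real (N\<^sup>2) / real q + 1)" for n
      proof (cases "coprime n q")
        case True
        have "real (card {m \<in> {1..N\<^sup>2}. R n m}) \<le> real (card {d. d dvd q}) * (2 * real (N\<^sup>2) / real q + 1)"
          using card_square_cong_le[OF _ True, of "N\<^sup>2"] True q by (simp add: R_def)
        also have "\<dots> \<le> T * (2 * real (N\<^sup>2) / real q + 1)"
          using T(2)[of q] q by (intro mult_right_mono) auto
        finally show ?thesis .
      next
        case False
        then show ?thesis using T(1) by (simp add: R_def)
      qed
    qed (use T in auto)
    finally show ?thesis by (simp add: B_def)
  qed
  define h where "h = real H / sqrt (real q)"
  define n where "n = real N / sqrt (real q)"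
  have hn: "h \<ge> 0" "n \<ge> 0" "h\<^sup>2 = real (H\<^sup>2) / real q" "n\<^sup>2 = real (N\<^sup>2) / real q"
    by (auto simp: h_def n_def power_divide)
  have "(real (card S))\<^sup>2 \<le> ((real H)\<^sup>2 * ((h\<^sup>2 + 1) * T)) * ((real N)\<^sup>2 * (T * (2 * n\<^sup>2 + 1) * T))"
    using CS A B mult_mono[OF A B] T(1) unfolding hn(3,4) by (simp add: B_def)
  \<comment> \<open>Passing to squares of linear forms here, and from \<open>T ^ 3\<close> to
    \<open>T ^ 4\<close> below, makes the right-hand side a perfect square whose root can be
    taken.\<close>
  also have "\<dots> \<le> ((real H)\<^sup>2 * ((1 + h)\<^sup>2 * T)) * ((real N)\<^sup>2 * (T * (1 + 2 * n)\<^sup>2 * T))"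
  proof -
    have "h\<^sup>2 + 1 \<le> (1 + h)\<^sup>2" "2 * n\<^sup>2 + 1 \<le> (1 + 2 * n)\<^sup>2"
      using hn(1,2) by (simp_all add: power2_eq_square algebra_simps)
    then show ?thesis using T(1) by (intro mult_mono) auto
  qed
  also have "\<dots> = T ^ 3 * ((real H * (1 + h)) * (real N * (1 + 2 * n)))\<^sup>2"
    by (simp add: power2_eq_square power3_eq_cube mult_ac)
  also have "\<dots> \<le> T ^ 4 * ((real H * (1 + h)) * (real N * (1 + 2 * n)))\<^sup>2"
    using T(1) by (intro mult_right_mono power_increasing) auto
  also have "\<dots> = (T\<^sup>2 * (real H * (1 + h)) * (real N * (1 + 2 * n)))\<^sup>2"
    by (simp add: power_mult_distrib)
  finally have "real (card S) \<le> T\<^sup>2 * (real H * (1 + h)) * (real N * (1 + 2 * n))"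
    by (rule power2_le_imp_le) (use hn in auto)
  then show ?thesis unfolding S_def h_def n_def times_divide_eq_right .
qed

section \<open>The second moment of the dual sums\<close>

text \<open>Up to the reflection \<^term>\<open>k\<close> to \<^term>\<open>q - k\<close>, this majorises the \<^term>\<open>k\<close>-th Fourier
  coefficient of the discrepancy. It does so only when \<^term>\<open>q\<close> divides no \<^term>\<open>k * d\<^sup>2\<close>, since
  otherwise the second argument of the minimum is the junk value 0.\<close>
definition dual_majorant :: "real \<Rightarrow> nat set \<Rightarrow> nat \<Rightarrow> nat \<Rightarrow> real" where
  "dual_majorant x D q k = (\<Sum>d\<in>D. min (x / (real d)\<^sup>2) (real q / real (k * d\<^sup>2 mod q)))"

text \<open>The four products arising from expanding the brackets are bounded by interpolating
  between the two bounds for \<^term>\<open>m\<close>.\<close>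
lemma dyadic_block_bound:
  fixes m x q P R :: real
  assumes "0 \<le> m" "m \<le> x / P\<^sup>2" "m \<le> q / R" "P > 0" "R \<ge> 1" "q > 0" "x \<ge> 0"
  shows "m\<^sup>2 * ((2 * R * (1 + 2 * R / sqrt q)) * (2 * P * (1 + 4 * P / sqrt q)))
    \<le> 32 * q * (sqrt (x * q) + x / sqrt q + sqrt q * P + P\<^sup>2)"
proof -
  define s where "s = sqrt q"
  have s: "s > 0" "q = s\<^sup>2" using assms by (auto simp: s_def)
  have m1: "m * P\<^sup>2 \<le> x" using assms by (simp add: field_simps)
  have m2: "m * R \<le> q" using assms by (simp add: field_simps)
  have "(m\<^sup>2 * (R * P))\<^sup>2 \<le> (q * sqrt (x * q))\<^sup>2"
  proof -
    \<comment> \<open>The interpolation uses one factor \<open>m * P\<^sup>2\<close> and three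
      factors \<open>m * R\<close>. The extra \<open>R\<close> on the left is matched on the right
      through \<open>R \<ge> 1\<close> and then cancelled.\<close>
    have "(m\<^sup>2 * (R * P))\<^sup>2 * R = (m * P\<^sup>2) * (m * R) ^ 3"
      by (simp add: power2_eq_square power3_eq_cube mult_ac)
    also have "\<dots> \<le> x * q ^ 3" using assms by (intro mult_mono power_mono m1 m2) auto
    also have "x * q ^ 3 = q\<^sup>2 * (x * q)" by (simp add: power2_eq_square power3_eq_cube)
    also have "\<dots> = (q * sqrt (x * q))\<^sup>2 * 1"
      using assms by (simp only: power_mult_distrib) simp
    also have "\<dots> \<le> (q * sqrt (x * q))\<^sup>2 * R" using assms by (intro mult_left_mono) auto
    finally show ?thesis using assms by simp
  qed
  then have t1: "m\<^sup>2 * (R * P) \<le> q * sqrt (x * q)"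
    by (rule power2_le_imp_le) (use assms in auto)
  have "(m * P\<^sup>2) * (m * R) \<le> x * q" using assms m1 m2 by (intro mult_mono) auto
  then have t2: "m\<^sup>2 * (R * P\<^sup>2) / s \<le> q * (x / s)"
    using s(1) by (simp add: field_simps power2_eq_square)
  have mR: "(m * R)\<^sup>2 \<le> q\<^sup>2" using assms m2 by (intro power_mono) auto
  have "(m * R)\<^sup>2 * P / s \<le> q\<^sup>2 * P / s"
    using mR assms s(1) by (intro divide_right_mono mult_right_mono) auto
  also have "\<dots> = q * (s * P)" using s by (simp add: power2_eq_square field_simps)
  finally have t3: "m\<^sup>2 * (R\<^sup>2 * P) / s \<le> q * (s * P)" by (simp add: power_mult_distrib mult_ac)
  have "(m * R)\<^sup>2 * P\<^sup>2 / q \<le> q\<^sup>2 * P\<^sup>2 / q"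
    using mR assms by (intro divide_right_mono mult_right_mono) auto
  also have "\<dots> = q * P\<^sup>2" using assms by (simp add: power2_eq_square)
  finally have t4: "m\<^sup>2 * (R\<^sup>2 * P\<^sup>2) / q \<le> q * P\<^sup>2" by (simp add: power_mult_distrib mult_ac)
  have "m\<^sup>2 * ((2 * R * (1 + 2 * R / s)) * (2 * P * (1 + 4 * P / s)))
    \<le> m\<^sup>2 * ((2 * R * (2 * (1 + R / s))) * (2 * P * (4 * (1 + P / s))))"
  proof -
    have "1 + 2 * R / s \<le> 2 * (1 + R / s)" "1 + 4 * P / s \<le> 4 * (1 + P / s)" by simp_all
    moreover have "R / s \<ge> 0" "P / s \<ge> 0" using assms s by auto
    ultimately show ?thesis using assms(4,5) by (intro mult_left_mono mult_mono) auto
  qed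
  also have "\<dots> = 32 * (m\<^sup>2 * (R * P) + m\<^sup>2 * (R * P\<^sup>2) / s + m\<^sup>2 * (R\<^sup>2 * P) / s + m\<^sup>2 * (R\<^sup>2 * P\<^sup>2) / q)"
  proof -
    have "1 / q = (1 / s) * (1 / s)" by (simp add: s(2) power2_eq_square)
    then show ?thesis unfolding divide_inverse by (simp add: algebra_simps power2_eq_square)
  qed
  also have "\<dots> \<le> 32 * (q * sqrt (x * q) + q * (x / s) + q * (s * P) + q * P\<^sup>2)"
    using t1 t2 t3 t4 by (intro mult_left_mono add_mono) auto
  also have "\<dots> = 32 * q * (sqrt (x * q) + x / s + s * P + P\<^sup>2)" by (simp add: algebra_simps)
  finally show ?thesis by (simp add: s_def)
qed

text \<open>Sort the \<open>d\<close> by the binary sizes of \<open>d\<close> and of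
  \<open>k * d\<^sup>2 mod q\<close>. On a block all terms are at most one \<open>m\<close>, so the
  second moment over \<open>k\<close> is at most \<open>m\<^sup>2\<close> times the count of
  \<open>card_small_multiples_le\<close>. Cauchy-Schwarz over the \<open>L\<^sup>2\<close> blocks
  costs \<open>L\<^sup>2\<close>, and adding the block bounds costs another
  \<open>L\<^sup>2\<close>. For unit \<open>k\<close> no residue is 0, so the minimum never
  degenerates.\<close>

lemma sum_dual_majorant_totatives_le:
  fixes q N L :: nat and D :: "nat set" and T x :: real
  assumes q: "q > 1" "q \<le> 2 ^ L" and N: "N < 2 ^ L" and x: "x \<ge> 0"
    and D: "D \<subseteq> {1..N}" "\<And>d. d \<in> D \<Longrightarrow> coprime d q"
    and T: "T \<ge> 1" "\<And>n. 1 \<le> n \<Longrightarrow> n \<le> 4 * q\<^sup>2 \<or> n \<le> 4 * N\<^sup>2 \<Longrightarrow> real (card {d. d dvd n}) \<le> T"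
  shows "(\<Sum>k\<in>totatives q. (dual_majorant x D q k)\<^sup>2)
    \<le> 32 * real L ^ 4 * T\<^sup>2 * (real q * (sqrt (x * q) + x / sqrt q + sqrt q * N + (real N)\<^sup>2))"
proof -
  \<comment> \<open>\<open>l n\<close> is the binary logarithm of \<open>n\<close> rounded down;
    nothing is known about \<open>l 0\<close>.\<close>
  have "\<exists>l. \<forall>n::nat. n > 0 \<longrightarrow> 2 ^ l n \<le> n \<and> n < 2 ^ (l n + 1)"
    by (rule choice) (use ex_power_ivl1[of 2] in auto)
  then obtain l where l: "\<And>n::nat. n > 0 \<Longrightarrow> 2 ^ l n \<le> n \<and> n < 2 ^ (l n + 1)" by blast
  define I where "I = {..<L} \<times> {..<L}"
  define Z where "Z = (\<lambda>k i. {d \<in> D. (l d, l (k * d\<^sup>2 mod q)) = i})"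
  define c where "c = (\<lambda>k d. min (x / (real d)\<^sup>2) (real q / real (k * d\<^sup>2 mod q)))"
  define M where "M = real q * (sqrt (x * q) + x / sqrt q + sqrt q * N + (real N)\<^sup>2)"
  have finD: "finite D" using D(1) finite_subset by blast
  have finZ: "finite (Z k i)" for k i using finD by (auto simp: Z_def)
  have c0: "c k d \<ge> 0" for k d using x by (simp add: c_def)
  have r: "0 < k * d\<^sup>2 mod q \<and> k * d\<^sup>2 mod q < q" if "k \<in> totatives q" "d \<in> D" for k d
  proof -
    have "coprime (k * d\<^sup>2 mod q) q" using that D(2) q by (simp add: in_totatives_iff)
    then have "k * d\<^sup>2 mod q \<noteq> 0" using q by (intro notI) simp
    then show ?thesis using q by simp
  qed
  have lL: "l n < L" if "0 < n" "n < 2 ^ L" for n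
  proof -
    have "(2::nat) ^ l n < 2 ^ L" using l[OF that(1)] that(2) by linarith
    then show ?thesis by simp
  qed
  have block: "(\<Sum>k\<in>totatives q. (\<Sum>d\<in>Z k i. c k d)\<^sup>2) \<le> 32 * T\<^sup>2 * M" if i: "i \<in> I" for i
  proof (cases "\<forall>k\<in>totatives q. Z k i = {}")
    case True
    then show ?thesis using x by (simp add: M_def)
  next
    case False
    obtain a b where ab: "i = (a, b)" by (cases i)
    define P where "P = (2::real) ^ a"
    define R where "R = (2::real) ^ b"
    define m where "m = min (x / P\<^sup>2) (real q / R)"
    define E where "E = {d \<in> D. l d = a}"
    have m0: "m \<ge> 0" using x by (simp add: m_def P_def R_def)
    \<comment> \<open>A witness in the block gives \<open>2 ^ a \<le> N\<close> and
      \<open>2 ^ b \<le> q\<close>. The numbers whose divisors are counted thus stay below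
      \<open>4 * N\<^sup>2\<close> or \<open>4 * q\<^sup>2\<close>, where \<open>T\<close>
      applies.\<close>
    obtain k0 d0 where kd: "k0 \<in> totatives q" "d0 \<in> D" "l d0 = a" "l (k0 * d0\<^sup>2 mod q) = b"
      using False by (auto simp: Z_def ab)
    have aN: "2 ^ a \<le> N" using l[of d0] kd D(1) by force
    have bq: "2 ^ b \<le> q" using l[of "k0 * d0\<^sup>2 mod q"] kd r[OF kd(1,2)] by force
    have cm: "c k d \<le> m" if "k \<in> totatives q" "d \<in> Z k i" for k d
    proof -
      have d: "d \<in> D" "l d = a" "l (k * d\<^sup>2 mod q) = b" using that by (auto simp: Z_def ab)
      have dP: "P \<le> real d" using l[of d] d D(1) by (force simp: P_def)
      have dR: "R \<le> real (k * d\<^sup>2 mod q)" using l[of "k * d\<^sup>2 mod q"] d r[OF that(1) d(1)]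
        by (metis R_def of_nat_le_iff of_nat_numeral of_nat_power)
      have "x / (real d)\<^sup>2 \<le> x / P\<^sup>2"
        using dP x by (intro frac_le power_mono) (auto simp: P_def)
      moreover have "real q / real (k * d\<^sup>2 mod q) \<le> real q / R"
        using dR by (intro frac_le) (auto simp: R_def)
      ultimately show ?thesis by (auto simp: c_def m_def)
    qed
    have "(\<Sum>k\<in>totatives q. (\<Sum>d\<in>Z k i. c k d)\<^sup>2) \<le> (\<Sum>k\<in>totatives q. (m * real (card (Z k i)))\<^sup>2)"
    proof (intro sum_mono power_mono sum_nonneg c0)
      fix k assume k: "k \<in> totatives q"
      have "(\<Sum>d\<in>Z k i. c k d) \<le> (\<Sum>d\<in>Z k i. m)" using cm k by (intro sum_mono) auto
      then show "(\<Sum>d\<in>Z k i. c k d) \<le> m * real (card (Z k i))" by (simp add: mult.commute)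
    qed
    \<comment> \<open>A squared cardinality counts pairs \<open>(d, e)\<close>, so the sum over
      \<open>k\<close> counts triples \<open>(k, d, e)\<close>.\<close>
    also have "\<dots> = m\<^sup>2 * real (\<Sum>k\<in>totatives q. card (Z k i \<times> Z k i))"
      by (simp add: sum_distrib_left card_cartesian_product power2_eq_square mult_ac)
    also have "(\<Sum>k\<in>totatives q. card (Z k i \<times> Z k i)) = card (SIGMA k : totatives q. Z k i \<times> Z k i)"
      using finZ by (intro card_SigmaI[symmetric]) auto
    also have "m\<^sup>2 * real (card (SIGMA k : totatives q. Z k i \<times> Z k i))
      \<le> m\<^sup>2 * (T\<^sup>2 * (real (2 ^ (b + 1)) * (1 + real (2 ^ (b + 1)) / sqrt (real q)))
             * (real (2 ^ (a + 1)) * (1 + 2 * real (2 ^ (a + 1)) / sqrt (real q))))"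
    proof (intro mult_left_mono)
      have "card (SIGMA k : totatives q. Z k i \<times> Z k i) \<le>
        card {(k, d, e). k \<in> totatives q \<and> (d \<in> E \<and> k * d\<^sup>2 mod q \<le> 2 ^ (b + 1)) \<and> e \<in> E \<and> k * e\<^sup>2 mod q \<le> 2 ^ (b + 1)}"
      proof (rule card_mono)
        show "finite {(k, d, e). k \<in> totatives q \<and> (d \<in> E \<and> k * d\<^sup>2 mod q \<le> 2 ^ (b + 1)) \<and> e \<in> E \<and> k * e\<^sup>2 mod q \<le> 2 ^ (b + 1)}"
          by (rule finite_subset[of _ "totatives q \<times> D \<times> D"]) (use finD in \<open>auto simp: E_def\<close>)
        have "k * d\<^sup>2 mod q \<le> 2 ^ (b + 1)" if "k \<in> totatives q" "d \<in> Z k i" for k d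
          using that l[of "k * d\<^sup>2 mod q"] r[of k d] by (auto simp: Z_def ab less_imp_le)
        then show "(SIGMA k : totatives q. Z k i \<times> Z k i) \<subseteq> {(k, d, e). k \<in> totatives q \<and> (d \<in> E \<and> k * d\<^sup>2 mod q \<le> 2 ^ (b + 1)) \<and> e \<in> E \<and> k * e\<^sup>2 mod q \<le> 2 ^ (b + 1)}"
          by (auto simp: Z_def ab E_def)
      qed
      also have "real \<dots> \<le> T\<^sup>2 * (real (2 ^ (b + 1)) * (1 + real (2 ^ (b + 1)) / sqrt (real q)))
             * (real (2 ^ (a + 1)) * (1 + 2 * real (2 ^ (a + 1)) / sqrt (real q)))"
      proof (rule card_small_multiples_le[OF q(1)])
        show "E \<subseteq> {1..2 ^ (a + 1)}"
        proof
          fix d assume "d \<in> E"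
          then show "d \<in> {1..2 ^ (a + 1)}" using l[of d] D(1) by (auto simp: E_def)
        qed
        fix n :: nat assume n: "1 \<le> n" "n \<le> (2 ^ (b + 1))\<^sup>2 \<or> n \<le> (2 ^ (a + 1))\<^sup>2 \<or> n \<le> q"
        have "(2 ^ (b + 1))\<^sup>2 \<le> 4 * q\<^sup>2" "(2 ^ (a + 1))\<^sup>2 \<le> 4 * N\<^sup>2"
          using power_mono[OF bq, of 2] power_mono[OF aN, of 2] by (simp_all add: power_mult_distrib)
        moreover have "q \<le> 4 * q\<^sup>2" by (simp add: power2_eq_square)
        ultimately have "n \<le> 4 * q\<^sup>2 \<or> n \<le> 4 * N\<^sup>2" using n(2) by linarith
        then show "real (card {d. d dvd n}) \<le> T" using n(1) by (intro T(2))
      qed (use T(1) D(2) in \<open>auto simp: E_def\<close>)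
      finally show "real (card (SIGMA k : totatives q. Z k i \<times> Z k i))
        \<le> T\<^sup>2 * (real (2 ^ (b + 1)) * (1 + real (2 ^ (b + 1)) / sqrt (real q)))
             * (real (2 ^ (a + 1)) * (1 + 2 * real (2 ^ (a + 1)) / sqrt (real q)))"
        by (simp only: of_nat_le_iff)
    qed auto
    also have "\<dots> = T\<^sup>2 * (m\<^sup>2 * ((2 * R * (1 + 2 * R / sqrt q)) * (2 * P * (1 + 4 * P / sqrt q))))"
      by (simp add: P_def R_def mult_ac)
    also have "\<dots> \<le> T\<^sup>2 * (32 * real q * (sqrt (x * q) + x / sqrt q + sqrt q * P + P\<^sup>2))"
      by (rule mult_left_mono[OF dyadic_block_bound]) (use m0 q x in \<open>auto simp: m_def P_def R_def\<close>)
    also have "\<dots> \<le> T\<^sup>2 * (32 * real q * (sqrt (x * q) + x / sqrt q + sqrt q * N + (real N)\<^sup>2))"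
    proof -
      have "P \<le> real N" using aN by (metis P_def of_nat_le_iff of_nat_numeral of_nat_power)
      moreover have "P \<ge> 0" by (simp add: P_def)
      ultimately show ?thesis by (intro mult_left_mono add_mono power_mono) auto
    qed
    finally show ?thesis by (simp add: M_def mult_ac)
  qed
  have "(\<Sum>k\<in>totatives q. (dual_majorant x D q k)\<^sup>2)
      \<le> (\<Sum>k\<in>totatives q. (\<Sum>i\<in>I. (\<Sum>d\<in>Z k i. c k d)\<^sup>2) * real (card I))"
  proof (rule sum_mono)
    fix k assume k: "k \<in> totatives q"
    have "(\<Sum>i\<in>I. \<Sum>d\<in>Z k i. c k d) = (\<Sum>d\<in>D. c k d)"
      unfolding Z_def
    proof (rule sum.group)
      show "(\<lambda>d. (l d, l (k * d\<^sup>2 mod q))) ` D \<subseteq> I"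
      proof safe
        fix d assume d: "d \<in> D"
        then have "0 < d" "d < 2 ^ L" using D(1) N by force+
        moreover have "k * d\<^sup>2 mod q < 2 ^ L" using r[OF k d] q by linarith
        ultimately show "(l d, l (k * d\<^sup>2 mod q)) \<in> I"
          using lL r[OF k d] by (simp add: I_def)
      qed
    qed (use finD in \<open>auto simp: I_def\<close>)
    then have "(dual_majorant x D q k)\<^sup>2 = (\<Sum>i\<in>I. \<Sum>d\<in>Z k i. c k d)\<^sup>2"
      by (simp add: dual_majorant_def c_def)
    also have "\<dots> \<le> (\<Sum>i\<in>I. (\<Sum>d\<in>Z k i. c k d)\<^sup>2) * real (card I)"
      by (rule sum_squared_le_sum_of_squares)
    finally show "(dual_majorant x D q k)\<^sup>2 \<le> \<dots>" .
  qed
  also have "\<dots> = (\<Sum>i\<in>I. \<Sum>k\<in>totatives q. (\<Sum>d\<in>Z k i. c k d)\<^sup>2) * real (card I)"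
    unfolding sum_distrib_right[symmetric] by (subst sum.swap) (rule refl)
  also have "\<dots> \<le> (\<Sum>i\<in>I. 32 * T\<^sup>2 * M) * real (card I)"
    using block by (intro mult_right_mono sum_mono) auto
  also have "\<dots> = 32 * real L ^ 4 * T\<^sup>2 * M"
    by (simp add: I_def card_cartesian_product eval_nat_numeral)
  finally show ?thesis by (simp add: M_def)
qed

text \<open>The majorant depends only on the fraction \<open>k / q\<close>: with
  \<open>k = g * j\<close> and \<open>q = g * e\<close>, both \<open>q\<close> and
  \<open>k * d\<^sup>2 mod q\<close> carry the factor \<open>g\<close>, and their quotient is
  unchanged. So each \<open>k\<close> is sorted by its reduced denominator \<open>e\<close>, which
  exceeds 1 since \<open>0 < k < q\<close>.\<close>

lemma sum_dual_majorant_le_divisors: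
  assumes q: "q > 0"
  shows "(\<Sum>k\<in>{1..<q}. (dual_majorant x D q k)\<^sup>2)
    \<le> (\<Sum>e | e dvd q \<and> e > 1. \<Sum>k\<in>totatives e. (dual_majorant x D e k)\<^sup>2)"
proof -
  let ?E = "{e. e dvd q \<and> e > 1}"
  have finE: "finite ?E" using q by simp
  have "(\<Sum>k\<in>{1..<q}. (dual_majorant x D q k)\<^sup>2)
    \<le> (\<Sum>(e, k)\<in>Sigma ?E totatives. (dual_majorant x D e k)\<^sup>2)"
  proof (rule sum_le_included[where i = "\<lambda>(e, k). k * (q div e)"])
    show "\<forall>k\<in>{1..<q}. \<exists>y\<in>Sigma ?E totatives. (case y of (e, k) \<Rightarrow> k * (q div e)) = k \<and>
        (dual_majorant x D q k)\<^sup>2 \<le> (case y of (e, k) \<Rightarrow> (dual_majorant x D e k)\<^sup>2)"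
    proof
      fix k assume k: "k \<in> {1..<q}"
      define g where "g = gcd k q"
      define j where "j = k div g"
      define e where "e = q div g"
      have g: "g > 0" "g \<le> k" using k by (auto simp: g_def)
      have kg: "k = g * j" and qg: "q = g * e" by (simp_all add: j_def e_def g_def)
      have e1: "e > 1"
      proof (rule ccontr)
        assume "\<not> e > 1"
        then have "g * e \<le> g * 1" by (intro mult_le_mono2) simp
        then have "q \<le> g" using qg by linarith
        then show False using k g by simp
      qed
      have "coprime j e" unfolding j_def e_def g_def using q by (intro div_gcd_coprime) auto
      moreover have "j \<le> e" using k kg qg g by (metis atLeastLessThan_iff less_imp_le mult_le_cancel1)
      moreover have "j > 0" using k kg by (intro Nat.gr0I) auto
      ultimately have "j \<in> totatives e" by (simp add: in_totatives_iff)
      moreover have "real q / real (k * d\<^sup>2 mod q) = real e / real (j * d\<^sup>2 mod e)" for d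
      proof -
        have "k * d\<^sup>2 mod q = g * (j * d\<^sup>2 mod e)" by (simp add: kg qg mult.assoc)
        then show ?thesis using g by (simp add: qg)
      qed
      then have "dual_majorant x D q k = dual_majorant x D e j" by (simp add: dual_majorant_def)
      moreover have "j * (q div e) = k" using e1 by (simp add: kg qg)
      moreover have "e dvd q" by (simp add: qg)
      ultimately show "\<exists>y\<in>Sigma ?E totatives. (case y of (e, k) \<Rightarrow> k * (q div e)) = k \<and>
        (dual_majorant x D q k)\<^sup>2 \<le> (case y of (e, k) \<Rightarrow> (dual_majorant x D e k)\<^sup>2)"
        using e1 by (intro bexI[of _ "(e, j)"]) auto
    qed
  qed (use finE in auto)
  also have "\<dots> = (\<Sum>e\<in>?E. \<Sum>k\<in>totatives e. (dual_majorant x D e k)\<^sup>2)"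
    using finE by (subst sum.Sigma) auto
  finally show ?thesis .
qed

section \<open>Fourier analysis on residue classes\<close>

text \<open>The bound is symmetric under \<open>t\<close> to \<open>1 - t\<close>, and its
  reciprocal splits as \<open>1 / t + 1 / (1 - t)\<close>, which later separates the residues
  \<open>r\<close> and \<open>q - r\<close>. By symmetry it suffices to bound the sine below by
  \<open>u\<close> on the first half of the interval.\<close>

lemma sin_pi_ge:
  fixes t :: real
  assumes "0 \<le> t" "t \<le> 1"
  shows "sin (pi * t) \<ge> t * (1 - t)"
proof -
  have half: "sin (pi * u) \<ge> u" if "0 \<le> u" "u \<le> 1 / 2" for u :: real
  proof -
    define v where "v = pi * u"
    have v: "0 \<le> v" "v \<le> 2" using that mult_mono[of pi 4 u "1/2"] pi_less_4 by (auto simp: v_def)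
    have "\<bar>sin v - (\<Sum>m<3. sin_coeff m * v ^ m)\<bar> \<le> inverse (fact 3) * \<bar>v\<bar> ^ 3"
      by (rule Maclaurin_sin_bound)
    moreover have "(\<Sum>m<3. sin_coeff m * v ^ m) = v"
      by (simp add: sin_coeff_def eval_nat_numeral)
    ultimately have "\<bar>sin v - v\<bar> \<le> v ^ 3 / 6" using v by (simp add: fact_numeral)
    from abs_le_D2[OF this] have "sin v \<ge> v - v ^ 3 / 6" by (simp add: algebra_simps)
    \<comment> \<open>As \<open>v \<le> 2\<close>, the cubic Taylor term removes at most two thirds
      of \<open>v\<close>; the remaining third is at least \<open>u\<close> because
      \<open>pi > 3\<close>.\<close>
    moreover have "v ^ 3 \<le> 4 * v"
    proof -
      have "v\<^sup>2 \<le> 2\<^sup>2" using v by (intro power_mono)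
      then have "v * v\<^sup>2 \<le> v * 4" using v by (intro mult_left_mono) auto
      then show ?thesis by (simp add: power3_eq_cube power2_eq_square mult_ac)
    qed
    moreover have "v \<ge> 3 * u" using that pi_gt3 by (auto simp: v_def intro!: mult_right_mono)
    ultimately show ?thesis unfolding v_def by linarith
  qed
  show ?thesis
  proof (cases "t \<le> 1 / 2")
    case True
    have "t * (1 - t) \<le> t" using assms by (simp add: mult_left_le)
    then show ?thesis using half[of t] True assms by linarith
  next
    case False
    have "sin (pi * (1 - t)) = sin (pi * t)"
      by (simp add: right_diff_distrib sin_diff)
    moreover have "t * (1 - t) \<le> 1 - t" using assms by (simp add: mult_left_le_one_le)
    ultimately show ?thesis using half[of "1 - t"] False assms by linarith
  qed
qed

section \<open>Roots of unity: geometric sums, orthogonality, Parseval\<close>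

definition root_of_unity :: "nat \<Rightarrow> complex" where
  "root_of_unity q = cis (2 * pi / real q)"

lemma norm_root_of_unity [simp]: "norm (root_of_unity q) = 1"
  by (simp add: root_of_unity_def)

lemma root_of_unity_power_self: "q > 0 \<Longrightarrow> root_of_unity q ^ q = 1"
  by (simp add: root_of_unity_def Complex.DeMoivre)

lemma root_of_unity_power_cong:
  assumes "q > 0" "[m = n] (mod q)"
  shows "root_of_unity q ^ m = root_of_unity q ^ n"
proof -
  have *: "root_of_unity q ^ i = root_of_unity q ^ (i mod q)" for i
  proof -
    have "root_of_unity q ^ i = root_of_unity q ^ (q * (i div q) + i mod q)" by simp
    also have "\<dots> = root_of_unity q ^ (i mod q)"
      using assms(1) by (simp only: power_add power_mult root_of_unity_power_self power_one mult_1)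
    finally show ?thesis .
  qed
  show ?thesis using *[of m] *[of n] assms(2) by (simp add: cong_def)
qed

text \<open>The chord from 1 to \<open>cis (2 * s)\<close> has length
  \<open>2 * \<bar>sin s\<bar>\<close>; here \<open>s = pi * r / q\<close>.\<close>

lemma norm_one_minus_root_of_unity_power:
  assumes "r < q"
  shows "norm (1 - root_of_unity q ^ r) \<ge> 2 * (real r / real q) * (1 - real r / real q)"
proof -
  define t where "t = real r / real q"
  have t: "0 \<le> t" "t \<le> 1" using assms by (auto simp: t_def)
  have e: "root_of_unity q ^ r = cis (2 * (pi * t))"
    by (simp add: root_of_unity_def Complex.DeMoivre t_def mult_ac)
  have "(norm (1 - cis (2 * (pi * t))))\<^sup>2 = (1 - cos (2 * (pi * t)))\<^sup>2 + (sin (2 * (pi * t)))\<^sup>2"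
    by (simp add: cmod_power2)
  also have "\<dots> = 2 - 2 * cos (2 * (pi * t))"
    using sin_cos_squared_add[of "2 * (pi * t)"] by (simp add: power2_eq_square algebra_simps)
  also have "\<dots> = (2 * sin (pi * t))\<^sup>2" by (simp add: cos_double_sin power_mult_distrib)
  finally have "norm (1 - cis (2 * (pi * t))) = \<bar>2 * sin (pi * t)\<bar>"
    by (metis abs_norm_cancel power2_eq_iff abs_power2 power2_abs real_sqrt_abs)
  then show ?thesis using sin_pi_ge[OF t] unfolding e by (simp add: t_def abs_if)
qed

lemma root_of_unity_power_neq_1: "0 < r \<Longrightarrow> r < q \<Longrightarrow> root_of_unity q ^ r \<noteq> 1"
  using norm_one_minus_root_of_unity_power[of r q] by (auto simp: field_simps)

text \<open>Multiplication by \<open>1 - z\<close> telescopes the sum to two terms of modulus 1. The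
  two quotients together stand in for the reciprocal distance of \<open>r / q\<close> to the nearest
  integer.\<close>

lemma norm_geometric_sum_root_of_unity_le:
  assumes r: "0 < r" "r < q"
  shows "norm (\<Sum>m\<in>{1..M}. (root_of_unity q ^ r) ^ m) \<le> real q / real r + real q / real (q - r)"
proof -
  define z where "z = root_of_unity q ^ r"
  define t where "t = real r / real q"
  have t: "0 < t" "t < 1" using r by (auto simp: t_def)
  have z1: "norm (1 - z) \<ge> 2 * (t * (1 - t))"
    using norm_one_minus_root_of_unity_power[OF r(2)] by (simp add: z_def t_def)
  have "(1 - z) * (\<Sum>m\<in>{1..M}. z ^ m) = z - z ^ Suc M"
    by (induction M) (simp_all add: distrib_left left_diff_distrib)
  then have "norm (1 - z) * norm (\<Sum>m\<in>{1..M}. z ^ m) = norm (z - z ^ Suc M)"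
    by (metis norm_mult)
  also have "\<dots> \<le> norm z + norm (z ^ Suc M)" by (rule norm_triangle_ineq4)
  also have "\<dots> = 2" by (simp add: z_def norm_power norm_mult)
  finally have "2 * (t * (1 - t)) * norm (\<Sum>m\<in>{1..M}. z ^ m) \<le> 2"
    using mult_right_mono[OF z1 norm_ge_zero[of "\<Sum>m\<in>{1..M}. z ^ m"]] by linarith
  then have "norm (\<Sum>m\<in>{1..M}. z ^ m) \<le> 1 / (t * (1 - t))"
    using t by (simp add: field_simps)
  also have "\<dots> = 1 / t + 1 / (1 - t)" using t by (simp add: field_simps)
  also have "1 / t = real q / real r" by (simp add: t_def)
  also have "1 / (1 - t) = real q / real (q - r)" using r by (simp add: t_def of_nat_diff field_simps)
  finally show ?thesis by (simp add: z_def)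
qed

text \<open>A geometric sum of length \<open>q\<close> whose ratio satisfies
  \<open>w ^ q = 1\<close> vanishes unless \<open>w = 1\<close>. Classes are indexed by
  \<open>{1..q}\<close> because this contains \<open>totatives q\<close>, also for
  \<open>q = 1\<close>.\<close>

lemma root_of_unity_orthogonality:
  assumes q: "q > 0" and ab: "a \<in> {1..q}" "b \<in> {1..q}"
  shows "(\<Sum>k<q. root_of_unity q ^ (k * a) * cnj (root_of_unity q ^ (k * b))) = (if a = b then of_nat q else 0)"
proof -
  define w where "w = root_of_unity q ^ a * cnj (root_of_unity q ^ b)"
  have nc: "root_of_unity q ^ n * cnj (root_of_unity q ^ n) = 1" for n
    using complex_norm_square[of "root_of_unity q ^ n"] by (simp add: norm_power)
  have "(\<Sum>k<q. root_of_unity q ^ (k * a) * cnj (root_of_unity q ^ (k * b))) = (\<Sum>k<q. w ^ k)"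
    by (simp add: w_def power_mult_distrib mult.commute flip: power_mult)
  also have "\<dots> = (if a = b then of_nat q else 0)"
  proof (cases "a = b")
    case True
    then show ?thesis by (simp only: w_def nc) simp
  next
    case False
    have "w \<noteq> 1"
    proof
      assume "w = 1"
      then have eq: "root_of_unity q ^ a = root_of_unity q ^ b"
        using nc[of b] unfolding w_def by (metis (no_types, lifting) mult.assoc mult.commute mult_1)
      have neq: "root_of_unity q ^ i \<noteq> root_of_unity q ^ j" if "i < j" "i \<ge> 1" "j \<le> q" for i j
      proof
        assume "root_of_unity q ^ i = root_of_unity q ^ j"
        also have "\<dots> = root_of_unity q ^ i * root_of_unity q ^ (j - i)"
          using that by (simp flip: power_add)
        finally have "root_of_unity q ^ (j - i) = 1"
          by (simp add: root_of_unity_def)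
        then show False using root_of_unity_power_neq_1[of "j - i" q] that by simp
      qed
      show False using eq neq[of a b] neq[of b a] False ab by (cases a b rule: linorder_cases) auto
    qed
    moreover have "w ^ q = 1"
    proof -
      have "w ^ q = (root_of_unity q ^ q) ^ a * cnj ((root_of_unity q ^ q) ^ b)"
        by (simp add: w_def power_mult_distrib mult.commute flip: power_mult)
      then show ?thesis using q by (simp add: root_of_unity_power_self)
    qed
    ultimately show ?thesis using False by (simp add: geometric_sum)
  qed
  finally show ?thesis .
qed

lemma finite_Parseval:
  fixes F :: "nat \<Rightarrow> complex"
  assumes q: "q > 0"
  shows "(\<Sum>k<q. (norm (\<Sum>a\<in>{1..q}. F a * root_of_unity q ^ (k * a)))\<^sup>2) = real q * (\<Sum>a\<in>{1..q}. (norm (F a))\<^sup>2)"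
proof -
  let ?e = "\<lambda>k a. root_of_unity q ^ (k * a)"
  have "complex_of_real (\<Sum>k<q. (norm (\<Sum>a\<in>{1..q}. F a * ?e k a))\<^sup>2)
      = (\<Sum>k<q. \<Sum>a\<in>{1..q}. \<Sum>b\<in>{1..q}. F a * cnj (F b) * (?e k a * cnj (?e k b)))"
    by (simp only: of_real_sum complex_norm_square cnj_sum complex_cnj_mult sum_product mult_ac)
  also have "\<dots> = (\<Sum>a\<in>{1..q}. \<Sum>b\<in>{1..q}. F a * cnj (F b) * (\<Sum>k<q. ?e k a * cnj (?e k b)))"
    unfolding sum_distrib_left
    by (subst sum.swap, rule sum.cong[OF refl], rule sum.swap)
  also have "\<dots> = (\<Sum>a\<in>{1..q}. \<Sum>b\<in>{1..q}. if a = b then F a * cnj (F b) * of_nat q else 0)"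
    using q by (intro sum.cong refl) (simp add: root_of_unity_orthogonality del: complex_cnj_power)
  also have "\<dots> = (\<Sum>a\<in>{1..q}. of_nat q * (F a * cnj (F a)))"
    by (intro sum.cong refl) (simp add: mult_ac)
  also have "\<dots> = complex_of_real (real q * (\<Sum>a\<in>{1..q}. (norm (F a))\<^sup>2))"
    by (simp only: of_real_mult of_real_sum complex_norm_square sum_distrib_left of_real_of_nat_eq)
  finally show ?thesis by (simp only: of_real_eq_iff)
qed

section \<open>Counts in residue classes and their Fourier coefficients\<close>

lemma sum_residue_delta:
  fixes g :: "nat \<Rightarrow> 'a::comm_monoid_add"
  assumes q: "q > 0" and g: "\<And>a b. [a = b] (mod q) \<Longrightarrow> g a = g b"
  shows "(\<Sum>a\<in>{1..q}. if [n = a] (mod q) then g a else 0) = g n"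
proof -
  \<comment> \<open>The class of 0 is represented by \<open>q\<close>, as the index set is
    \<open>{1..q}\<close>.\<close>
  define r where "r = (if n mod q = 0 then q else n mod q)"
  have r: "r \<in> {1..q}" "[n = r] (mod q)" using q by (auto simp: r_def cong_def less_imp_le)
  have "[n = a] (mod q) \<longleftrightarrow> a = r" if "a \<in> {1..q}" for a
  proof
    assume "[n = a] (mod q)"
    then have "[a = r] (mod q)" using r(2) cong_sym cong_trans by blast
    then have "a mod q = r mod q" by (simp add: cong_def)
    then show "a = r" using that r(1)
      by (metis atLeastAtMost_iff le_neq_implies_less mod_less mod_self not_one_le_zero)
  qed (use r in auto)
  then have "(\<Sum>a\<in>{1..q}. if [n = a] (mod q) then g a else 0) = (\<Sum>a\<in>{1..q}. if a = r then g a else 0)"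
    by (intro sum.cong) auto
  also have "\<dots> = g r" using r(1) by simp
  finally show ?thesis using g[OF r(2)] by simp
qed

text \<open>For \<open>d > 0\<close> this counts the \<open>n \<le> x\<close> in the class of
  \<open>a\<close> with \<open>d\<^sup>2 dvd n\<close>, through the cofactor \<open>m\<close> of
  \<open>n = m * d\<^sup>2\<close>. Its expected value is \<open>x / d\<^sup>2 / q\<close> if
  \<open>d\<close> is coprime to \<open>q\<close>.\<close>

definition cong_count :: "real \<Rightarrow> nat \<Rightarrow> nat \<Rightarrow> nat \<Rightarrow> nat" where
  "cong_count x q d a = card {m \<in> {1..nat \<lfloor>x / (real d)\<^sup>2\<rfloor>}. [m * d\<^sup>2 = a] (mod q)}"

text \<open>Each \<open>m\<close> is counted in exactly one class, so exchanging the sums leaves a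
  geometric sum over \<open>m\<close>.\<close>

lemma sum_cong_count:
  assumes "q > 0"
  shows "(\<Sum>a\<in>{1..q}. complex_of_nat (cong_count x q d a) * root_of_unity q ^ (k * a))
    = (\<Sum>m\<in>{1..nat \<lfloor>x / (real d)\<^sup>2\<rfloor>}. (root_of_unity q ^ (k * d\<^sup>2)) ^ m)"
proof -
  let ?M = "{1..nat \<lfloor>x / (real d)\<^sup>2\<rfloor>}"
  have "(\<Sum>a\<in>{1..q}. complex_of_nat (cong_count x q d a) * root_of_unity q ^ (k * a))
    = (\<Sum>a\<in>{1..q}. \<Sum>m\<in>?M. if [m * d\<^sup>2 = a] (mod q) then root_of_unity q ^ (k * a) else 0)"
    by (intro sum.cong refl) (simp add: cong_count_def flip: sum.inter_filter)
  also have "\<dots> = (\<Sum>m\<in>?M. \<Sum>a\<in>{1..q}. if [m * d\<^sup>2 = a] (mod q) then root_of_unity q ^ (k * a) else 0)"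
    by (rule sum.swap)
  also have "\<dots> = (\<Sum>m\<in>?M. root_of_unity q ^ (k * (m * d\<^sup>2)))"
    using assms by (intro sum.cong refl sum_residue_delta root_of_unity_power_cong cong_mult) auto
  also have "\<dots> = (\<Sum>m\<in>?M. (root_of_unity q ^ (k * d\<^sup>2)) ^ m)"
    by (intro sum.cong refl) (simp add: mult_ac flip: power_mult)
  finally show ?thesis .
qed

text \<open>This gives each of the reflected residues \<open>r\<close> and \<open>q - r\<close> its
  own minimum with the trivial bound \<open>a\<close>.\<close>

lemma le_min_add_min:
  fixes w :: real
  shows "w \<le> a \<Longrightarrow> w \<le> b + c \<Longrightarrow> 0 \<le> a \<Longrightarrow> 0 \<le> b \<Longrightarrow> 0 \<le> c \<Longrightarrow> w \<le> min a b + min a c"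
  by (auto simp: min_def)

text \<open>By Parseval it suffices to bound each frequency. At 0 only the rounding error of
  \<open>x / d\<^sup>2\<close> remains, at most 1 for each \<open>d\<close>. Elsewhere the expected
  value drops out, since the roots of unity sum to 0, and a geometric sum at the residue
  \<open>k * d\<^sup>2 mod q\<close> remains. The factor 4 comes from
  \<open>(A + B)\<^sup>2 \<le> 2 * A\<^sup>2 + 2 * B\<^sup>2\<close> and the reflection of
  \<open>k\<close> to \<open>q - k\<close>.\<close>

lemma sum_square_discrepancy_le:
  fixes x :: real and D :: "nat set" and \<mu> :: "nat \<Rightarrow> real"
  assumes q: "q > 0" and x: "x \<ge> 0" and D: "finite D" "\<And>d. d \<in> D \<Longrightarrow> coprime d q"
    and \<mu>: "\<And>d. \<bar>\<mu> d\<bar> \<le> 1"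
  shows "real q * (\<Sum>a\<in>{1..q}. (\<Sum>d\<in>D. \<mu> d * (real (cong_count x q d a) - x / (real d)\<^sup>2 / real q))\<^sup>2)
    \<le> (real (card D))\<^sup>2 + 4 * (\<Sum>k\<in>{1..<q}. (dual_majorant x D q k)\<^sup>2)"
proof -
  define F where "F = (\<lambda>a. \<Sum>d\<in>D. \<mu> d * (real (cong_count x q d a) - x / (real d)\<^sup>2 / real q))"
  define G where "G = (\<lambda>k. \<Sum>a\<in>{1..q}. complex_of_real (F a) * root_of_unity q ^ (k * a))"
  \<comment> \<open>\<open>W k d\<close> is the contribution of a single \<open>d\<close> to the
    coefficient \<open>G k\<close>, before weighting by \<open>\<mu> d\<close>.\<close>
  define W where "W = (\<lambda>k d. (\<Sum>m\<in>{1..nat \<lfloor>x / (real d)\<^sup>2\<rfloor>}. (root_of_unity q ^ (k * d\<^sup>2)) ^ m)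
     - complex_of_real (x / (real d)\<^sup>2 / real q) * (\<Sum>a\<in>{1..q}. root_of_unity q ^ (k * a)))"
  have GW: "G k = (\<Sum>d\<in>D. complex_of_real (\<mu> d) * W k d)" for k
  proof -
    have "G k = (\<Sum>d\<in>D. \<Sum>a\<in>{1..q}. complex_of_real (\<mu> d) *
        (complex_of_nat (cong_count x q d a) * root_of_unity q ^ (k * a)
           - complex_of_real (x / (real d)\<^sup>2 / real q) * root_of_unity q ^ (k * a)))"
      unfolding G_def F_def of_real_sum sum_distrib_right
      by (subst sum.swap) (simp add: algebra_simps)
    also have "\<dots> = (\<Sum>d\<in>D. complex_of_real (\<mu> d) * W k d)"
      by (simp only: W_def sum_cong_count[OF q] sum_subtractf sum_distrib_left[symmetric])
    finally show ?thesis .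
  qed
  have normG: "norm (G k) \<le> (\<Sum>d\<in>D. norm (W k d))" for k
    unfolding GW
  proof (rule sum_norm_le)
    fix d
    have "\<bar>\<mu> d\<bar> * norm (W k d) \<le> 1 * norm (W k d)" using \<mu> by (intro mult_right_mono) auto
    then show "norm (complex_of_real (\<mu> d) * W k d) \<le> norm (W k d)" by (simp add: norm_mult)
  qed
  have "norm (G 0) \<le> (\<Sum>d\<in>D. 1)"
  proof (rule order_trans[OF normG sum_mono])
    fix d
    define y where "y = x / (real d)\<^sup>2"
    have "y \<ge> 0" using x by (simp add: y_def)
    have "W 0 d = complex_of_real (real (nat \<lfloor>y\<rfloor>) - y)" using q by (simp add: W_def y_def)
    moreover have "\<bar>real (nat \<lfloor>y\<rfloor>) - y\<bar> \<le> 1" using \<open>y \<ge> 0\<close> by linarith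
    ultimately show "norm (W 0 d) \<le> 1" by (simp only: norm_of_real)
  qed
  then have G0: "(norm (G 0))\<^sup>2 \<le> (real (card D))\<^sup>2" by (intro power_mono) auto
  have Gk: "norm (G k) \<le> dual_majorant x D q k + dual_majorant x D q (q - k)" if k: "k \<in> {1..<q}" for k
    unfolding dual_majorant_def sum.distrib[symmetric]
  proof (rule order_trans[OF normG sum_mono])
    fix d assume d: "d \<in> D"
    define r where "r = k * d\<^sup>2 mod q"
    define M where "M = nat \<lfloor>x / (real d)\<^sup>2\<rfloor>"
    \<comment> \<open>This excludes the degenerate minimum in the majorant: \<open>d\<close> is a
      unit and \<open>0 < k < q\<close>.\<close>
    have "\<not> q dvd k * d\<^sup>2"
    proof
      assume "q dvd k * d\<^sup>2"
      then have "q dvd k" using D(2)[OF d] by (simp add: coprime_dvd_mult_left_iff coprime_commute)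
      then show False using k by (auto dest: dvd_imp_le)
    qed
    then have r: "0 < r" "r < q" using q by (auto simp: r_def dvd_eq_mod_eq_0)
    \<comment> \<open>Reflecting \<open>k\<close> reflects the residue, so the second quotient in
      the geometric bound belongs to the majorant at \<open>q - k\<close>.\<close>
    have qr: "(q - k) * d\<^sup>2 mod q = q - r"
    proof -
      have "[r + (q - k) * d\<^sup>2 = k * d\<^sup>2 + (q - k) * d\<^sup>2] (mod q)"
        by (intro cong_add) (simp_all add: r_def cong_def)
      also have "k * d\<^sup>2 + (q - k) * d\<^sup>2 = q * d\<^sup>2" using k by (simp flip: add_mult_distrib)
      also have "[q * d\<^sup>2 = r + (q - r)] (mod q)" using r by (simp add: cong_def)
      finally have "[(q - k) * d\<^sup>2 = q - r] (mod q)" by (simp add: cong_add_lcancel_nat)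
      then show ?thesis using r by (simp add: cong_def)
    qed
    have "root_of_unity q ^ k \<noteq> 1" using root_of_unity_power_neq_1 k by simp
    moreover have "(root_of_unity q ^ k) ^ q = 1"
      using q by (metis mult.commute power_mult power_one root_of_unity_power_self)
    ultimately have "(\<Sum>a\<in>{1..q}. root_of_unity q ^ (k * a)) = 0"
      by (simp add: sum_gp power_mult)
    then have W: "W k d = (\<Sum>m\<in>{1..M}. (root_of_unity q ^ r) ^ m)"
      using root_of_unity_power_cong[OF q, of "k * d\<^sup>2" r] by (simp add: W_def M_def r_def)
    have "norm (W k d) \<le> (\<Sum>m\<in>{1..M}. 1)"
      unfolding W by (intro sum_norm_le) (simp add: norm_power)
    also have "\<dots> \<le> x / (real d)\<^sup>2" using x by (simp add: M_def)
    finally have "norm (W k d) \<le> x / (real d)\<^sup>2" .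
    moreover have "norm (W k d) \<le> real q / real r + real q / real (q - r)"
      unfolding W by (rule norm_geometric_sum_root_of_unity_le[OF r])
    moreover have "x / (real d)\<^sup>2 \<ge> 0" "real q / real r \<ge> 0" "real q / real (q - r) \<ge> 0"
      using x by auto
    ultimately show "norm (W k d) \<le> min (x / (real d)\<^sup>2) (real q / real (k * d\<^sup>2 mod q))
        + min (x / (real d)\<^sup>2) (real q / real ((q - k) * d\<^sup>2 mod q))"
      unfolding qr r_def[symmetric] by (rule le_min_add_min)
  qed
  have sym: "(\<Sum>k\<in>{1..<q}. (dual_majorant x D q (q - k))\<^sup>2) = (\<Sum>k\<in>{1..<q}. (dual_majorant x D q k)\<^sup>2)"
    by (rule sum.reindex_bij_witness[of _ "\<lambda>k. q - k" "\<lambda>k. q - k"]) auto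
  have "(\<Sum>k\<in>{1..<q}. (norm (G k))\<^sup>2) \<le>
      (\<Sum>k\<in>{1..<q}. 2 * (dual_majorant x D q k)\<^sup>2 + 2 * (dual_majorant x D q (q - k))\<^sup>2)"
  proof (rule sum_mono)
    fix k assume k: "k \<in> {1..<q}"
    have "(norm (G k))\<^sup>2 \<le> (dual_majorant x D q k + dual_majorant x D q (q - k))\<^sup>2"
      using Gk[OF k] by (intro power_mono) auto
    also have "\<dots> \<le> 2 * (dual_majorant x D q k)\<^sup>2 + 2 * (dual_majorant x D q (q - k))\<^sup>2"
      using zero_le_power2[of "dual_majorant x D q k - dual_majorant x D q (q - k)"]
      by (simp add: power2_eq_square algebra_simps)
    finally show "(norm (G k))\<^sup>2 \<le> \<dots>" .
  qed
  also have "\<dots> = 4 * (\<Sum>k\<in>{1..<q}. (dual_majorant x D q k)\<^sup>2)"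
    by (simp only: sum.distrib sum_distrib_left[symmetric] sym)
  finally have "(\<Sum>k\<in>{1..<q}. (norm (G k))\<^sup>2) \<le> 4 * (\<Sum>k\<in>{1..<q}. (dual_majorant x D q k)\<^sup>2)" .
  moreover have "real q * (\<Sum>a\<in>{1..q}. (F a)\<^sup>2) = (\<Sum>k<q. (norm (G k))\<^sup>2)"
    using finite_Parseval[OF q, of "\<lambda>a. complex_of_real (F a)"] by (simp add: G_def)
  moreover have "(\<Sum>k<q. (norm (G k))\<^sup>2) = (norm (G 0))\<^sup>2 + (\<Sum>k\<in>{1..<q}. (norm (G k))\<^sup>2)"
  proof -
    have "{..<q} = insert 0 {1..<q}" using q by auto
    then show ?thesis by simp
  qed
  ultimately show ?thesis using G0 unfolding F_def by linarith
qed

section \<open>Square divisors and the density\<close>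

lemma moebius_mu_1 [simp]: "moebius_mu (Suc 0) = 1"
  by (simp add: moebius_mu_def)

lemma abs_moebius_mu: "\<bar>moebius_mu n\<bar> = (if squarefree n then 1 else 0)"
  by (simp add: moebius_mu_def power_abs)

lemma abs_moebius_mu_le: "\<bar>real_of_int (moebius_mu d)\<bar> \<le> 1"
  using abs_moebius_mu[of d] by (metis of_int_abs of_int_0 of_int_1 order_refl zero_le_one)

lemma moebius_mu_prime_mult:
  assumes p: "prime p" "\<not> p dvd d"
  shows "moebius_mu (p * d) = - moebius_mu d"
proof -
  have d: "d \<noteq> 0" using p by (auto intro: Nat.gr0I)
  have "prime_factors (p * d) = insert p (prime_factors d)"
    using p d by (simp add: prime_factorization_mult prime_factorization_prime)
  moreover have "p \<notin> prime_factors d" using p by (auto simp: prime_factors_dvd)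
  moreover have "squarefree (p * d) \<longleftrightarrow> squarefree d"
    using p by (auto intro: squarefree_mult_coprime squarefree_prime prime_imp_coprime
        squarefree_mono[of d "p * d"])
  ultimately show ?thesis by (simp add: moebius_mu_def)
qed

text \<open>If \<^term>\<open>p\<^sup>2\<close> divides \<^term>\<open>n\<close>, then \<^term>\<open>d\<close> and \<^term>\<open>p * d\<close> cancel.\<close>
lemma sum_moebius_mu_square_divisors:
  assumes n: "n > 0"
  shows "(\<Sum>d | d\<^sup>2 dvd n. moebius_mu d) = \<bar>moebius_mu n\<bar>"
proof (cases "squarefree n")
  case True
  then have "{d. d\<^sup>2 dvd n} = {1}" by (auto simp: squarefree_def)
  then show ?thesis using True by (simp add: abs_moebius_mu)
next
  case False
  then obtain p where p: "prime p" "p\<^sup>2 dvd n"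
    using n by (auto simp: squarefree_factorial_semiring)
  define S where "S = {d. d\<^sup>2 dvd n}"
  have d_le: "d \<le> n" if "d \<in> S" for d
  proof -
    have "d dvd n" using that by (auto simp: S_def power2_eq_square intro: dvd_mult_left)
    then show ?thesis using n by (auto dest: dvd_imp_le)
  qed
  have fin: "finite S" by (rule finite_subset[of _ "{..n}"]) (use d_le in auto)
  have "sum moebius_mu S = sum moebius_mu {d \<in> S. \<not> p dvd d} + sum moebius_mu {d \<in> S. p dvd d}"
    using fin by (subst sum.union_disjoint[symmetric]) (auto intro!: sum.cong)
  \<comment> \<open>Multiples of \<open>p\<^sup>2\<close> are not squarefree; the remaining
    multiples of \<open>p\<close> in \<open>S\<close> are exactly the \<open>p * d\<close> with
    \<open>d\<close> in \<open>S\<close> prime to \<open>p\<close>.\<close>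
  also have "sum moebius_mu {d \<in> S. p dvd d} = sum moebius_mu {d \<in> S. p dvd d \<and> \<not> p\<^sup>2 dvd d}"
  proof (rule sum.mono_neutral_right)
    have "\<not> squarefree d" if "p\<^sup>2 dvd d" for d
      using that p(1) unfolding squarefree_def by (auto dest: spec[of _ p])
    then show "\<forall>d\<in>{d \<in> S. p dvd d} - {d \<in> S. p dvd d \<and> \<not> p\<^sup>2 dvd d}. moebius_mu d = 0"
      by (auto simp: moebius_mu_def)
  qed (use fin in auto)
  also have "{d \<in> S. p dvd d \<and> \<not> p\<^sup>2 dvd d} = (\<lambda>d. p * d) ` {d \<in> S. \<not> p dvd d}"
  proof (intro equalityI subsetI)
    fix d assume "d \<in> {d \<in> S. p dvd d \<and> \<not> p\<^sup>2 dvd d}"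
    then obtain e where "d = p * e" "(p * e)\<^sup>2 dvd n" "\<not> p\<^sup>2 dvd p * e" by (auto simp: S_def)
    moreover from this have "e\<^sup>2 dvd n" by (simp add: power_mult_distrib) (rule dvd_mult_right)
    ultimately show "d \<in> (\<lambda>d. p * d) ` {d \<in> S. \<not> p dvd d}"
      using p(1) by (auto simp: S_def power2_eq_square)
  next
    fix d assume "d \<in> (\<lambda>d. p * d) ` {d \<in> S. \<not> p dvd d}"
    then obtain e where e: "d = p * e" "e\<^sup>2 dvd n" "\<not> p dvd e" by (auto simp: S_def)
    then have "coprime (p\<^sup>2) (e\<^sup>2)" using p(1) by (simp add: prime_imp_coprime)
    then have "p\<^sup>2 * e\<^sup>2 dvd n" using e p(2) by (intro divides_mult)
    then show "d \<in> {d \<in> S. p dvd d \<and> \<not> p\<^sup>2 dvd d}"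
      using e p(1) by (auto simp: S_def power_mult_distrib power2_eq_square)
  qed
  also have "sum moebius_mu \<dots> = (\<Sum>d\<in>{d \<in> S. \<not> p dvd d}. moebius_mu (p * d))"
    using p(1) by (subst sum.reindex) (auto simp: inj_on_def)
  also have "\<dots> = - sum moebius_mu {d \<in> S. \<not> p dvd d}"
    unfolding sum_negf[symmetric] using p(1) by (intro sum.cong) (auto simp: moebius_mu_prime_mult)
  finally show ?thesis using False by (simp add: S_def moebius_mu_def)
qed

text \<open>Insert the sum over square divisors and exchange the sums. Since \<open>a\<close> is a
  unit, so is every \<open>n\<close> in its class, and only \<open>d\<close> coprime to
  \<open>q\<close> can occur. For \<open>d\<^sup>2 > x\<close> the count is 0.\<close>

lemma sqfree_sum_eq_sum_cong_count:
  assumes x: "x \<ge> 0" and q: "q > 0" and a: "coprime a q"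
  shows "sqfree_sum x q a
    = (\<Sum>d | d \<in> {1..nat \<lfloor>x\<rfloor>} \<and> coprime d q. real_of_int (moebius_mu d) * real (cong_count x q d a))"
proof -
  define N where "N = {n. 1 \<le> n \<and> real n \<le> x \<and> [n = a] (mod q)}"
  define Z where "Z = {1..nat \<lfloor>x\<rfloor>}"
  have NZ: "N \<subseteq> Z" by (auto simp: N_def Z_def le_nat_floor)
  then have finN: "finite N" using finite_subset Z_def by blast
  have "sqfree_sum x q a = (\<Sum>n\<in>N. \<Sum>d\<in>Z. if d\<^sup>2 dvd n then real_of_int (moebius_mu d) else 0)"
    unfolding sqfree_sum_def N_def[symmetric]
  proof (rule sum.cong[OF refl])
    fix n assume n: "n \<in> N"
    then have n0: "n > 0" by (simp add: N_def)
    have "{d. d\<^sup>2 dvd n} = {d \<in> Z. d\<^sup>2 dvd n}"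
    proof -
      have "d \<in> Z" if "d\<^sup>2 dvd n" for d
      proof -
        have "d dvd n" using that by (auto simp: power2_eq_square intro: dvd_mult_left)
        then have "d \<le> n" "d > 0" using n0 by (auto dest: dvd_imp_le intro: Nat.gr0I)
        moreover have "n \<in> Z" using n NZ by blast
        ultimately show ?thesis by (simp add: Z_def)
      qed
      then show ?thesis by auto
    qed
    then have "\<bar>moebius_mu n\<bar> = (\<Sum>d\<in>{d \<in> Z. d\<^sup>2 dvd n}. moebius_mu d)"
      using sum_moebius_mu_square_divisors[OF n0] by simp
    then have "\<bar>real_of_int (moebius_mu n)\<bar> = (\<Sum>d\<in>{d \<in> Z. d\<^sup>2 dvd n}. real_of_int (moebius_mu d))"
      by (metis of_int_abs of_int_sum)
    then show "\<bar>real_of_int (moebius_mu n)\<bar> = (\<Sum>d\<in>Z. if d\<^sup>2 dvd n then real_of_int (moebius_mu d) else 0)"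
      by (rule trans) (rule sum.inter_filter, simp add: Z_def)
  qed
  also have "\<dots> = (\<Sum>d\<in>Z. real_of_int (moebius_mu d) * real (card {n \<in> N. d\<^sup>2 dvd n}))"
    by (subst sum.swap, rule sum.cong[OF refl]) (simp add: finN mult.commute flip: sum.inter_filter)
  also have "\<dots> = (\<Sum>d | d \<in> Z \<and> coprime d q. real_of_int (moebius_mu d) * real (card {n \<in> N. d\<^sup>2 dvd n}))"
  proof (rule sum.mono_neutral_right)
    have *: "{n \<in> N. d\<^sup>2 dvd n} = {}" if "\<not> coprime d q" for d
    proof -
      have "coprime d q" if "n \<in> N" "d\<^sup>2 dvd n" for n
      proof -
        have "coprime n q" using that(1) a by (auto simp: N_def dest: cong_imp_coprime cong_sym)
        moreover have "d dvd n" using that(2) by (auto simp: power2_eq_square intro: dvd_mult_left)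
        ultimately show ?thesis by (rule coprime_divisors[OF _ dvd_refl, rotated])
      qed
      then show ?thesis using that by blast
    qed
    show "\<forall>d\<in>Z - {d. d \<in> Z \<and> coprime d q}.
        real_of_int (moebius_mu d) * real (card {n \<in> N. d\<^sup>2 dvd n}) = 0"
    proof
      fix d assume "d \<in> Z - {d. d \<in> Z \<and> coprime d q}"
      then have "{n \<in> N. d\<^sup>2 dvd n} = {}" by (intro *) simp
      then show "real_of_int (moebius_mu d) * real (card {n \<in> N. d\<^sup>2 dvd n}) = 0"
        by (simp only: card.empty)
    qed
  qed (auto simp: Z_def)
  also have "\<dots> = (\<Sum>d | d \<in> Z \<and> coprime d q. real_of_int (moebius_mu d) * real (cong_count x q d a))"
  proof (rule sum.cong[OF refl])
    fix d assume "d \<in> {d. d \<in> Z \<and> coprime d q}"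
    then have d: "d > 0" by (simp add: Z_def)
    have le: "m \<le> nat \<lfloor>x / (real d)\<^sup>2\<rfloor> \<longleftrightarrow> real (m * d\<^sup>2) \<le> x" for m
      using d x by (simp add: le_nat_iff le_floor_iff pos_le_divide_eq)
    have "{n \<in> N. d\<^sup>2 dvd n} = (\<lambda>m. m * d\<^sup>2) ` {m \<in> {1..nat \<lfloor>x / (real d)\<^sup>2\<rfloor>}. [m * d\<^sup>2 = a] (mod q)}"
    proof (intro equalityI subsetI)
      fix n assume n: "n \<in> {n \<in> N. d\<^sup>2 dvd n}"
      then obtain m where "n = d\<^sup>2 * m" by blast
      then have m: "n = m * d\<^sup>2" "1 \<le> n" "real n \<le> x" "[n = a] (mod q)"
        using n by (simp_all add: N_def mult.commute)
      then have "m \<noteq> 0" by (intro notI) simp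
      then show "n \<in> (\<lambda>m. m * d\<^sup>2) ` {m \<in> {1..nat \<lfloor>x / (real d)\<^sup>2\<rfloor>}. [m * d\<^sup>2 = a] (mod q)}"
        using m le[of m] by (intro image_eqI[of _ _ m]) auto
    next
      fix n assume "n \<in> (\<lambda>m. m * d\<^sup>2) ` {m \<in> {1..nat \<lfloor>x / (real d)\<^sup>2\<rfloor>}. [m * d\<^sup>2 = a] (mod q)}"
      then obtain m where "n = m * d\<^sup>2" "1 \<le> m" "m \<le> nat \<lfloor>x / (real d)\<^sup>2\<rfloor>" "[m * d\<^sup>2 = a] (mod q)"
        by auto
      then show "n \<in> {n \<in> N. d\<^sup>2 dvd n}" using le[of m] d by (simp add: N_def)
    qed
    also have "card \<dots> = cong_count x q d a"
      unfolding cong_count_def using d by (intro card_image) (auto simp: inj_on_def)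
    finally show "real_of_int (moebius_mu d) * real (card {n \<in> N. d\<^sup>2 dvd n})
        = real_of_int (moebius_mu d) * real (cong_count x q d a)" by simp
  qed
  finally show ?thesis by (simp add: Z_def)
qed

section \<open>Truncation of the density series\<close>

lemma sum_inverse_squares_le:
  assumes "M > 0"
  shows "(\<Sum>d\<in>{M<..N}. 1 / (real d)\<^sup>2) \<le> 1 / real M"
proof (cases "M \<le> N")
  case True
  then have "(\<Sum>d\<in>{M<..N}. 1 / (real d)\<^sup>2) \<le> 1 / real M - 1 / real N"
  proof (induction rule: dec_induct)
    case (step n)
    have n: "real n > 0" using step assms by simp
    have "{M<..Suc n} = insert (Suc n) {M<..n}" using step by auto
    then have "(\<Sum>d\<in>{M<..Suc n}. 1 / (real d)\<^sup>2) = 1 / (real (Suc n))\<^sup>2 + (\<Sum>d\<in>{M<..n}. 1 / (real d)\<^sup>2)"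
      by simp
    \<comment> \<open>The new term is dominated by the telescoping one,
      \<open>1 / (n * (n + 1))\<close>.\<close>
    moreover have "1 / (real (Suc n))\<^sup>2 \<le> 1 / real n - 1 / real (Suc n)"
    proof -
      have "1 / real n - 1 / real (Suc n) = 1 / (real n * real (Suc n))"
        using n by (simp add: field_simps)
      moreover have "1 / (real (Suc n))\<^sup>2 \<le> 1 / (real n * real (Suc n))"
        using n by (intro frac_le) (auto simp: power2_eq_square)
      ultimately show ?thesis by simp
    qed
    ultimately show ?case using step.IH by linarith
  qed simp
  then show ?thesis by (simp add: algebra_simps) (smt (verit) divide_nonneg_nonneg of_nat_0_le_iff)
qed simp

text \<open>Adjoining a prime \<open>p\<close> to \<open>P\<close> splits the divisors of the
  product into the old ones and \<open>p\<close> times the old ones, on which the Moebius function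
  changes sign. This multiplies the sum by \<open>1 - 1 / p\<^sup>2\<close>.\<close>

lemma prod_one_minus_inverse_square:
  assumes "finite P" "\<And>p. p \<in> P \<Longrightarrow> prime p"
  shows "(\<Prod>p\<in>P. 1 - 1 / (real p)\<^sup>2) = (\<Sum>d | d dvd \<Prod>P. real_of_int (moebius_mu d) / (real d)\<^sup>2)"
  using assms
proof (induction P rule: finite_induct)
  case (insert p P)
  define m where "m = \<Prod>P"
  have p: "prime p" using insert by simp
  have m0: "m > 0" unfolding m_def using insert by (intro prod_pos) (auto simp: prime_gt_0_nat)
  have pm: "\<not> p dvd m"
  proof
    assume "p dvd m"
    then obtain r where "r \<in> P" "p dvd r"
      unfolding m_def using p insert(1) by (auto simp: prime_dvd_prod_iff)
    then have "p = r" using p insert.prems by (intro primes_dvd_imp_eq) auto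
    then show False using \<open>r \<in> P\<close> insert.hyps by simp
  qed
  have fin: "finite {d. d dvd m}" using m0 by simp
  have div: "{d. d dvd p * m} = {d. d dvd m} \<union> (\<lambda>d. p * d) ` {d. d dvd m}"
  proof (intro equalityI subsetI)
    fix d assume d: "d \<in> {d. d dvd p * m}"
    show "d \<in> {d. d dvd m} \<union> (\<lambda>d. p * d) ` {d. d dvd m}"
    proof (cases "p dvd d")
      case True
      then show ?thesis using d p by (auto simp: dvd_def)
    next
      case False
      then have "coprime p d" using p by (simp add: prime_imp_coprime)
      then show ?thesis using d by (auto simp: coprime_dvd_mult_right_iff coprime_commute)
    qed
  qed auto
  have "(\<Sum>d | d dvd \<Prod>(insert p P). real_of_int (moebius_mu d) / (real d)\<^sup>2)
      = (\<Sum>d | d dvd m. real_of_int (moebius_mu d) / (real d)\<^sup>2)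
        + (\<Sum>d\<in>(\<lambda>d. p * d) ` {d. d dvd m}. real_of_int (moebius_mu d) / (real d)\<^sup>2)"
    using insert(1,2) pm fin dvd_mult_left[of p _ m]
    by (simp add: m_def[symmetric] div) (subst sum.union_disjoint; auto)
  also have "(\<Sum>d\<in>(\<lambda>d. p * d) ` {d. d dvd m}. real_of_int (moebius_mu d) / (real d)\<^sup>2)
      = (\<Sum>d | d dvd m. real_of_int (moebius_mu (p * d)) / (real (p * d))\<^sup>2)"
    using p by (subst sum.reindex) (auto simp: inj_on_def)
  also have "\<dots> = (\<Sum>d | d dvd m. - (1 / (real p)\<^sup>2) * (real_of_int (moebius_mu d) / (real d)\<^sup>2))"
  proof (intro sum.cong refl)
    fix d assume "d \<in> {d. d dvd m}"
    then have "\<not> p dvd d" using pm dvd_trans by blast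
    then show "real_of_int (moebius_mu (p * d)) / (real (p * d))\<^sup>2
        = - (1 / (real p)\<^sup>2) * (real_of_int (moebius_mu d) / (real d)\<^sup>2)"
      by (simp add: moebius_mu_prime_mult[OF p] power_mult_distrib)
  qed
  also have "\<dots> = - (1 / (real p)\<^sup>2) * (\<Sum>d | d dvd m. real_of_int (moebius_mu d) / (real d)\<^sup>2)"
    by (simp only: sum_distrib_left)
  finally show ?case using insert by (simp add: m_def algebra_simps)
qed simp

text \<open>A partial Euler product expands into a finite sum over the divisors of a squarefree
  \<open>m\<close>. Once it reaches \<open>M\<close>, every squarefree \<open>d \<le> M\<close>
  coprime to \<open>q\<close> divides \<open>m\<close>, so it differs from the truncated series only
  by a tail dominated by that of \<open>1 / d\<^sup>2\<close>. The bound passes to the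
  limit.\<close>

lemma sqfree_density_approx:
  assumes q: "q > 0" and M: "M > 0"
  shows "\<bar>sqfree_density q - (\<Sum>d | d \<in> {1..M} \<and> coprime d q. real_of_int (moebius_mu d) / (real d)\<^sup>2)\<bar> \<le> 1 / real M"
proof -
  let ?f = "\<lambda>d. real_of_int (moebius_mu d) / (real d)\<^sup>2"
  let ?s = "\<Sum>d | d \<in> {1..M} \<and> coprime d q. ?f d"
  let ?g = "\<lambda>p. if prime p \<and> \<not> p dvd q then 1 - 1 / (real p)\<^sup>2 else 1"
  have "(\<lambda>n. \<Prod>p\<le>n. ?g p) \<longlonglongrightarrow> sqfree_density q"
    unfolding sqfree_density_def by (rule convergent_prod_LIMSEQ[OF convergent_prod_sqfree_density])
  then have lim: "(\<lambda>n. \<bar>(\<Prod>p\<le>n. ?g p) - ?s\<bar>) \<longlonglongrightarrow> \<bar>sqfree_density q - ?s\<bar>"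
    by (intro tendsto_intros)
  have bound: "\<bar>(\<Prod>p\<le>n. ?g p) - ?s\<bar> \<le> 1 / real M" if n: "n \<ge> M" for n
  proof -
    define P where "P = {p \<in> {..n}. prime p \<and> \<not> p dvd q}"
    define m where "m = \<Prod>P"
    have finP: "finite P" by (simp add: P_def)
    have m0: "m > 0" unfolding m_def by (intro prod_pos) (auto simp: P_def prime_gt_0_nat)
    have fin: "finite {d. d dvd m}" using m0 by simp
    have mq: "coprime m q"
      unfolding m_def by (intro prod_coprime_left) (auto simp: P_def prime_imp_coprime)
    have "(\<Prod>p\<le>n. ?g p) = (\<Prod>p\<in>P. 1 - 1 / (real p)\<^sup>2)"
      unfolding P_def by (rule prod.inter_filter[symmetric]) simp
    also have "\<dots> = (\<Sum>d | d dvd m. ?f d)"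
      unfolding m_def by (rule prod_one_minus_inverse_square[OF finP]) (simp add: P_def)
    also have "\<dots> = (\<Sum>d | d dvd m \<and> d \<le> M. ?f d) + (\<Sum>d | d dvd m \<and> M < d. ?f d)"
      using fin by (subst sum.union_disjoint[symmetric]) (auto intro!: sum.cong)
    also have "(\<Sum>d | d dvd m \<and> d \<le> M. ?f d) = ?s"
    proof (rule sum.mono_neutral_left)
      show "{d. d dvd m \<and> d \<le> M} \<subseteq> {d. d \<in> {1..M} \<and> coprime d q}"
        using m0 mq by (auto intro: Suc_leI Nat.gr0I coprime_divisors[OF _ dvd_refl])
      show "\<forall>d\<in>{d. d \<in> {1..M} \<and> coprime d q} - {d. d dvd m \<and> d \<le> M}. ?f d = 0"
      proof
        fix d assume d: "d \<in> {d. d \<in> {1..M} \<and> coprime d q} - {d. d dvd m \<and> d \<le> M}"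
        have "\<not> squarefree d"
        proof
          assume sf: "squarefree d"
          \<comment> \<open>Prime by prime: the multiplicity is at most 1 in the squarefree
            \<open>d\<close>, and at least 1 in \<open>m\<close> at each prime dividing
            \<open>d\<close>.\<close>
          have "d dvd m"
          proof (rule multiplicity_le_imp_dvd)
            show "d \<noteq> 0" using d by auto
            fix p :: nat assume p: "prime p"
            show "multiplicity p d \<le> multiplicity p m"
            proof (cases "p dvd d")
              case True
              then have "p \<le> d" "\<not> p dvd q" using d p by (auto intro: dvd_imp_le dest: coprime_common_divisor[of d q p])
              then have "p \<in> P" using d n p by (auto simp: P_def)
              then have "p dvd m" unfolding m_def using finP by (rule dvd_prodI[rotated])
              then have "multiplicity p m \<ge> 1"
                using m0 p by (simp add: Suc_le_eq prime_multiplicity_gt_zero_iff)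
              moreover have "multiplicity p d \<le> 1"
                using sf p \<open>d \<noteq> 0\<close> by (auto simp: squarefree_factorial_semiring'')
              ultimately show ?thesis by linarith
            qed (simp add: not_dvd_imp_multiplicity_0)
          qed
          then show False using d by auto
        qed
        then show "?f d = 0" by (simp add: moebius_mu_def)
      qed
    qed simp
    finally have eq: "(\<Prod>p\<le>n. ?g p) - ?s = (\<Sum>d | d dvd m \<and> M < d. ?f d)" by simp
    have "\<bar>\<Sum>d | d dvd m \<and> M < d. ?f d\<bar> \<le> (\<Sum>d | d dvd m \<and> M < d. 1 / (real d)\<^sup>2)"
    proof (rule order_trans[OF sum_abs sum_mono])
      fix d
      show "\<bar>?f d\<bar> \<le> 1 / (real d)\<^sup>2"
        using abs_moebius_mu_le[of d] by (simp add: divide_right_mono)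
    qed
    also have "\<dots> \<le> (\<Sum>d\<in>{M<..m}. 1 / (real d)\<^sup>2)"
      using m0 by (intro sum_mono2) (auto intro: dvd_imp_le)
    also have "\<dots> \<le> 1 / real M" by (rule sum_inverse_squares_le[OF M])
    finally show ?thesis by (simp only: eq)
  qed
  show ?thesis
    by (rule LIMSEQ_le_const2[OF lim]) (use bound in blast)
qed

section \<open>The mean discrepancy\<close>

lemma sum_cong_count_le:
  assumes "q > 0" "x \<ge> 0"
  shows "(\<Sum>a\<in>totatives q. real (cong_count x q d a)) \<le> x / (real d)\<^sup>2"
proof -
  \<comment> \<open>Frequency 0 of the transform adds up all classes, hence counts all
    \<open>m\<close>.\<close>
  have "complex_of_nat (\<Sum>a\<in>{1..q}. cong_count x q d a) = complex_of_nat (nat \<lfloor>x / (real d)\<^sup>2\<rfloor>)"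
    using sum_cong_count[OF assms(1), of x d 0] by simp
  then have eq: "(\<Sum>a\<in>{1..q}. cong_count x q d a) = nat \<lfloor>x / (real d)\<^sup>2\<rfloor>"
    by (simp only: of_nat_eq_iff)
  have "(\<Sum>a\<in>totatives q. cong_count x q d a) \<le> (\<Sum>a\<in>{1..q}. cong_count x q d a)"
    by (intro sum_mono2) (auto simp: in_totatives_iff)
  then have "real (\<Sum>a\<in>totatives q. cong_count x q d a) \<le> real (nat \<lfloor>x / (real d)\<^sup>2\<rfloor>)"
    unfolding eq by (rule of_nat_mono)
  also have "\<dots> \<le> x / (real d)\<^sup>2" using assms(2) by simp
  finally show ?thesis by simp
qed

text \<open>Two losses of size \<open>x / N\<close> arise. For \<open>d > N\<close> the counts are
  summed trivially over all classes; and cutting the density series at \<open>N\<close> costs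
  \<open>x / (q * N)\<close> in each of at most \<open>q\<close> classes.\<close>

lemma sum_abs_sqfree_error_le:
  fixes x :: real and q N :: nat
  assumes x: "x \<ge> 1" and q: "q > 0" and N: "N > 0" "real N \<le> x"
  defines "D \<equiv> {d. d \<in> {1..N} \<and> coprime d q}"
  defines "F \<equiv> \<lambda>a. \<Sum>d\<in>D. real_of_int (moebius_mu d) * (real (cong_count x q d a) - x / (real d)\<^sup>2 / real q)"
  shows "(\<Sum>a\<in>totatives q. \<bar>sqfree_error x q a\<bar>) \<le> (\<Sum>a\<in>totatives q. \<bar>F a\<bar>) + 2 * x / real N"
proof -
  define Z where "Z = nat \<lfloor>x\<rfloor>"
  define R where "R = {d. d \<in> {N<..Z} \<and> coprime d q}"
  define c where "c = (\<lambda>d a. real (cong_count x q d a))"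
  let ?m = "\<lambda>d. real_of_int (moebius_mu d)"
  have x0: "x \<ge> 0" using x by simp
  have NZ: "N \<le> Z" using N by (simp add: Z_def le_nat_floor)
  have fin: "finite D" "finite R" by (auto simp: D_def R_def)
  have pointwise: "\<bar>sqfree_error x q a\<bar> \<le> \<bar>F a\<bar> + (\<Sum>d\<in>R. c d a) + x / real q * (1 / real N)"
    if a: "a \<in> totatives q" for a
  proof -
    have "{d. d \<in> {1..Z} \<and> coprime d q} = D \<union> R" using NZ by (auto simp: D_def R_def)
    then have "sqfree_sum x q a = (\<Sum>d\<in>D \<union> R. ?m d * c d a)"
      using sqfree_sum_eq_sum_cong_count[OF x0 q, of a] a by (simp add: in_totatives_iff Z_def c_def)
    also have "\<dots> = (\<Sum>d\<in>D. ?m d * c d a) + (\<Sum>d\<in>R. ?m d * c d a)"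
      using fin by (intro sum.union_disjoint) (auto simp: D_def R_def)
    also have "(\<Sum>d\<in>D. ?m d * c d a) = F a + x / real q * (\<Sum>d\<in>D. ?m d / (real d)\<^sup>2)"
      unfolding F_def c_def sum_distrib_left sum.distrib[symmetric]
      by (intro sum.cong refl) (simp add: algebra_simps)
    finally have E: "sqfree_error x q a = F a + (\<Sum>d\<in>R. ?m d * c d a)
        - x / real q * (sqfree_density q - (\<Sum>d\<in>D. ?m d / (real d)\<^sup>2))"
      by (simp add: sqfree_error_def algebra_simps)
    have "\<bar>\<Sum>d\<in>R. ?m d * c d a\<bar> \<le> (\<Sum>d\<in>R. c d a)"
    proof (rule order_trans[OF sum_abs sum_mono])
      fix d
      show "\<bar>?m d * c d a\<bar> \<le> c d a"
        using mult_right_mono[OF abs_moebius_mu_le[of d], of "c d a"] by (simp add: abs_mult c_def)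
    qed
    moreover have "\<bar>x / real q * (sqfree_density q - (\<Sum>d\<in>D. ?m d / (real d)\<^sup>2))\<bar> \<le> x / real q * (1 / real N)"
      unfolding abs_mult D_def using x0 mult_left_mono[OF sqfree_density_approx[OF q N(1)], of "x / real q"]
      by simp
    ultimately show ?thesis unfolding E by linarith
  qed
  have "(\<Sum>a\<in>totatives q. \<bar>sqfree_error x q a\<bar>)
      \<le> (\<Sum>a\<in>totatives q. \<bar>F a\<bar> + (\<Sum>d\<in>R. c d a) + x / real q * (1 / real N))"
    using pointwise by (intro sum_mono)
  also have "\<dots> = (\<Sum>a\<in>totatives q. \<bar>F a\<bar>) + (\<Sum>d\<in>R. \<Sum>a\<in>totatives q. c d a)
      + real (totient q) * (x / real q * (1 / real N))"
    by (simp add: sum.distrib totient_def sum.swap[of _ R])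
  also have "(\<Sum>d\<in>R. \<Sum>a\<in>totatives q. c d a) \<le> x / real N"
  proof -
    have "(\<Sum>d\<in>R. \<Sum>a\<in>totatives q. c d a) \<le> (\<Sum>d\<in>R. x / (real d)\<^sup>2)"
      unfolding c_def using q x0 by (intro sum_mono sum_cong_count_le)
    also have "\<dots> \<le> (\<Sum>d\<in>{N<..Z}. x / (real d)\<^sup>2)"
      using x0 by (intro sum_mono2) (auto simp: R_def)
    also have "\<dots> = x * (\<Sum>d\<in>{N<..Z}. 1 / (real d)\<^sup>2)" by (simp add: sum_distrib_left)
    also have "\<dots> \<le> x * (1 / real N)" using x0 by (intro mult_left_mono sum_inverse_squares_le N)
    finally show ?thesis by simp
  qed
  also have "real (totient q) * (x / real q * (1 / real N)) \<le> real q * (x / real q * (1 / real N))"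
    using x0 totient_le[of q] by (intro mult_right_mono) auto
  also have "\<dots> = x / real N" using q by simp
  finally show ?thesis by (simp add: algebra_simps)
qed

text \<open>Parseval is combined with the dyadic bound at each divisor \<open>e > 1\<close> of
  \<open>q\<close>, of which there are at most \<open>T\<close>. The zero frequency fits into one
  more copy of the bound, so \<open>129 = 4 * 32 + 1\<close>.\<close>

lemma sum_square_discrepancy_bound:
  fixes q N L :: nat and D :: "nat set" and T x :: real and \<mu> :: "nat \<Rightarrow> real"
  assumes q: "q > 0" "q \<le> 2 ^ L" and N: "N < 2 ^ L" and L: "L > 0" and x: "x \<ge> 0"
    and D: "D \<subseteq> {1..N}" "\<And>d. d \<in> D \<Longrightarrow> coprime d q" and \<mu>: "\<And>d. \<bar>\<mu> d\<bar> \<le> 1"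
    and T: "T \<ge> 1" "\<And>n. 1 \<le> n \<Longrightarrow> n \<le> 4 * q\<^sup>2 \<or> n \<le> 4 * N\<^sup>2 \<Longrightarrow> real (card {d. d dvd n}) \<le> T"
  shows "(\<Sum>a\<in>{1..q}. (\<Sum>d\<in>D. \<mu> d * (real (cong_count x q d a) - x / (real d)\<^sup>2 / real q))\<^sup>2)
    \<le> 129 * real L ^ 4 * T ^ 4 * (sqrt (x * q) + x / sqrt q + sqrt q * N + (real N)\<^sup>2)"
    (is "?V \<le> _")
proof -
  define G where "G = (\<lambda>e::nat. sqrt (x * e) + x / sqrt e + sqrt e * N + (real N)\<^sup>2)"
  have G0: "G e \<ge> 0" for e using x by (simp add: G_def)
  \<comment> \<open>\<open>G\<close> itself may decrease because of \<open>x / sqrt e\<close>, but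
    the factor \<open>e\<close> in front compensates, so every divisor is dominated by
    \<open>e = q\<close>.\<close>
  have Gmono: "real e * G e \<le> real q * G q" if "0 < e" "e \<le> q" for e :: nat
  proof -
    have eq: "real e * (x / sqrt e) = x * sqrt e" for e :: nat
      by (cases "e = 0") (simp_all add: field_simps)
    have "real e * G e = e * sqrt (x * e) + x * sqrt e + e * (sqrt e * N) + e * (real N)\<^sup>2" for e :: nat
      unfolding G_def distrib_left eq by simp
    then show ?thesis
      using that x by (auto intro!: add_mono mult_mono real_sqrt_le_mono)
  qed
  define M where "M = real L ^ 4 * T\<^sup>2 * (real q * G q)"
  have M0: "M \<ge> 0" using G0 by (simp add: M_def)
  have divq: "real (card {e. e dvd q \<and> e > 1}) \<le> T"
  proof -
    have "card {e. e dvd q \<and> e > 1} \<le> card {e. e dvd q}" using q by (intro card_mono) auto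
    moreover have "real (card {e. e dvd q}) \<le> T"
      using q by (intro T(2)) (auto simp: power2_eq_square)
    ultimately show ?thesis by linarith
  qed
  have "(\<Sum>k\<in>{1..<q}. (dual_majorant x D q k)\<^sup>2)
      \<le> (\<Sum>e | e dvd q \<and> e > 1. \<Sum>k\<in>totatives e. (dual_majorant x D e k)\<^sup>2)"
    by (rule sum_dual_majorant_le_divisors[OF q(1)])
  also have "\<dots> \<le> (\<Sum>e | e dvd q \<and> e > 1. 32 * M)"
  proof (rule sum_mono)
    fix e assume "e \<in> {e. e dvd q \<and> e > 1}"
    then have e: "e dvd q" "e > 1" "e \<le> q" using q by (auto dest: dvd_imp_le)
    have "(\<Sum>k\<in>totatives e. (dual_majorant x D e k)\<^sup>2)
        \<le> 32 * real L ^ 4 * T\<^sup>2 * (real e * (sqrt (x * e) + x / sqrt e + sqrt e * N + (real N)\<^sup>2))"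
    proof (rule sum_dual_majorant_totatives_le)
      show "coprime d e" if "d \<in> D" for d
        using D(2)[OF that] e(1) by (rule coprime_divisors[OF dvd_refl, rotated])
      fix n assume n: "1 \<le> n" "n \<le> 4 * e\<^sup>2 \<or> n \<le> 4 * N\<^sup>2"
      have "4 * e\<^sup>2 \<le> 4 * q\<^sup>2" using e(3) by (simp add: power_mono)
      then show "real (card {d. d dvd n}) \<le> T" using n by (intro T(2)) linarith+
    qed (use e q N x D(1) T(1) in linarith)+
    also have "\<dots> \<le> 32 * real L ^ 4 * T\<^sup>2 * (real q * G q)"
      using Gmono[of e] e by (intro mult_left_mono) (simp_all add: G_def)
    finally show "(\<Sum>k\<in>totatives e. (dual_majorant x D e k)\<^sup>2) \<le> 32 * M" by (simp add: M_def)
  qed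
  also have "\<dots> \<le> T * (32 * M)"
    using divq M0 by (simp add: mult_right_mono)
  finally have Y: "4 * (\<Sum>k\<in>{1..<q}. (dual_majorant x D q k)\<^sup>2) \<le> 128 * (T * M)" by linarith
  have one: "1 \<le> real L ^ 4 * T ^ 3"
    using L T(1) mult_mono[of 1 "real L ^ 4" 1 "T ^ 3"] by (simp add: one_le_power)
  have cD: "(real (card D))\<^sup>2 \<le> T * M"
  proof -
    have "card D \<le> N" using D(1) card_mono[of "{1..N}" D] by simp
    then have "(real (card D))\<^sup>2 \<le> (real N)\<^sup>2" by (intro power_mono) auto
    also have "\<dots> \<le> G q" using x by (simp add: G_def)
    also have "\<dots> \<le> real q * G q" using q G0[of q] mult_right_mono[of 1 "real q" "G q"] by simp
    also have "\<dots> \<le> (real L ^ 4 * T ^ 3) * (real q * G q)"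
      using mult_right_mono[OF one, of "real q * G q"] G0[of q] by simp
    also have "\<dots> = T * M" by (simp add: M_def eval_nat_numeral)
    finally show ?thesis .
  qed
  have fin: "finite D" using D(1) finite_subset by blast
  have "real q * ?V \<le> (real (card D))\<^sup>2 + 4 * (\<Sum>k\<in>{1..<q}. (dual_majorant x D q k)\<^sup>2)"
    using q x fin D(2) \<mu> by (intro sum_square_discrepancy_le) auto
  also have "\<dots> \<le> 129 * (T * M)" using Y cD by linarith
  also have "\<dots> = real q * (129 * real L ^ 4 * T ^ 3 * G q)"
    by (simp add: M_def eval_nat_numeral)
  finally have "?V \<le> 129 * real L ^ 4 * T ^ 3 * G q" using q by simp
  \<comment> \<open>An even power of \<open>T\<close> keeps the bound a perfect square when a root
    is taken later.\<close>
  also have "\<dots> \<le> 129 * real L ^ 4 * T ^ 4 * G q"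
    using G0[of q] T(1) by (intro mult_right_mono mult_left_mono power_increasing) auto
  finally show ?thesis by (simp add: G_def)
qed

text \<open>Cauchy-Schwarz over at most \<open>q\<close> classes passes from the second moment to
  the first. The cut \<open>N\<close> balances the tail \<open>x / N\<close> against
  \<open>sqrt q * N\<close>, the contribution of \<open>N\<^sup>2\<close>; both then have the size
  of \<open>v\<close>.\<close>

lemma sum_abs_sqfree_error_bound:
  fixes x T :: real and q L :: nat
  assumes x: "x \<ge> 1" and q: "q > 0" "real q \<le> x" and L: "L > 0" "x < 2 ^ L"
    and T: "T \<ge> 1" "\<And>n. 1 \<le> n \<Longrightarrow> real n \<le> 4 * x\<^sup>2 \<Longrightarrow> real (card {d. d dvd n}) \<le> T"
  shows "(\<Sum>a\<in>totatives q. \<bar>sqfree_error x q a\<bar>)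
    \<le> 28 * (real L)\<^sup>2 * T\<^sup>2 * (x powr (1 / 4) * real q powr (3 / 4) + x powr (1 / 2) * real q powr (1 / 4))"
proof -
  \<comment> \<open>Fourth roots of \<open>x\<close> and \<open>q\<close> turn every quantity into a
    monomial in \<open>X\<close> and \<open>Q\<close>; \<open>u\<close> and \<open>v\<close> are the
    two terms of the bound.\<close>
  define X where "X = x powr (1 / 4)"
  define Q where "Q = real q powr (1 / 4)"
  have X: "X \<ge> 1" "X ^ 4 = x" and Q: "Q \<ge> 1" "Q ^ 4 = real q"
    using x q by (auto simp: X_def Q_def ge_one_powr_ge_zero powr_powr simp flip: powr_realpow)
  have QX: "Q \<le> X" unfolding X_def Q_def using q by (intro powr_mono2) auto
  have pw: "x powr (1 / 2) = X\<^sup>2" "real q powr (3 / 4) = Q ^ 3"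
    using x q by (auto simp: X_def Q_def powr_powr simp flip: powr_realpow)
  have sq: "sqrt x = X\<^sup>2" "sqrt (real q) = Q\<^sup>2"
    by (rule real_sqrt_unique; use X Q in \<open>simp flip: power_mult\<close>)+
  define u where "u = X * Q ^ 3"
  define v where "v = X\<^sup>2 * Q"
  have uv: "u \<ge> 0" "v \<ge> 0" using X Q by (auto simp: u_def v_def)
  define N where "N = nat \<lfloor>X\<^sup>2 / Q\<rfloor>"
  have y1: "X\<^sup>2 / Q \<ge> 1"
  proof -
    have "Q * 1 \<le> X * X" using QX X Q by (intro mult_mono) auto
    then show ?thesis using Q by (simp add: power2_eq_square)
  qed
  have N0: "N > 0" using y1 by (simp add: N_def)
  have "real N \<le> X\<^sup>2 / Q" "X\<^sup>2 / Q < real N + 1" using y1 unfolding N_def by linarith+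
  \<comment> \<open>Since \<open>N \<ge> 1\<close>, rounding down loses at most a factor 2.\<close>
  then have Ny: "real N \<le> X\<^sup>2 / Q" "X\<^sup>2 / Q \<le> 2 * real N" using N0 by linarith+
  have yx: "X\<^sup>2 / Q \<le> x"
  proof -
    have "X\<^sup>2 * 1 \<le> X\<^sup>2 * (X\<^sup>2 * Q)"
      using X Q mult_mono[of 1 "X\<^sup>2" 1 Q] by (intro mult_left_mono) (auto simp: one_le_power)
    also have "\<dots> = x * Q" by (simp add: X(2)[symmetric] eval_nat_numeral)
    finally show ?thesis using Q by (simp add: divide_le_eq)
  qed
  define D where "D = {d. d \<in> {1..N} \<and> coprime d q}"
  define F where "F = (\<lambda>a. \<Sum>d\<in>D. real_of_int (moebius_mu d) * (real (cong_count x q d a) - x / (real d)\<^sup>2 / real q))"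
  define V where "V = (\<Sum>a\<in>{1..q}. (F a)\<^sup>2)"
  have 1: "(\<Sum>a\<in>totatives q. \<bar>sqfree_error x q a\<bar>) \<le> (\<Sum>a\<in>totatives q. \<bar>F a\<bar>) + 2 * x / real N"
    unfolding F_def D_def using x q N0 Ny yx by (intro sum_abs_sqfree_error_le) auto
  have 2: "2 * x / real N \<le> 4 * v"
  proof -
    have "x = v * (X\<^sup>2 / Q)" using Q by (simp add: v_def X(2)[symmetric] eval_nat_numeral)
    also have "\<dots> \<le> v * (2 * real N)" using Ny uv by (intro mult_left_mono)
    finally show ?thesis using N0 by (simp add: divide_le_eq)
  qed
  have VG: "V \<le> 129 * real L ^ 4 * T ^ 4 * (sqrt (x * q) + x / sqrt q + sqrt q * N + (real N)\<^sup>2)"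
    unfolding V_def F_def
  proof (rule sum_square_discrepancy_bound)
    have "real q < 2 ^ L" "real N < 2 ^ L" using q L yx Ny by linarith+
    then have "real q < real (2 ^ L)" "real N < real (2 ^ L)" by simp_all
    then have "q < 2 ^ L" "N < 2 ^ L" by (simp_all only: of_nat_less_iff)
    then show "q \<le> 2 ^ L" "N < 2 ^ L" by simp_all
    fix n assume n: "1 \<le> n" "n \<le> 4 * q\<^sup>2 \<or> n \<le> 4 * N\<^sup>2"
    have "real N \<le> x" using Ny yx by linarith
    then have "(real N)\<^sup>2 \<le> x\<^sup>2" "(real q)\<^sup>2 \<le> x\<^sup>2" using q by (auto intro!: power_mono)
    moreover have "real n \<le> real (4 * q\<^sup>2) \<or> real n \<le> real (4 * N\<^sup>2)" using n(2) by (simp only: of_nat_le_iff)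
    ultimately show "real (card {d. d dvd n}) \<le> T" using n(1) by (intro T(2)) auto
  qed (use q L x T(1) abs_moebius_mu_le in \<open>auto simp: D_def\<close>)
  \<comment> \<open>Multiplied by \<open>q\<close>, the four terms are \<open>u\<^sup>2\<close>,
    \<open>v\<^sup>2\<close>, at most \<open>u\<^sup>2\<close> (giving away a factor
    \<open>Q\<close>), and at most \<open>v\<^sup>2\<close>.\<close>
  have G: "real q * (sqrt (x * q) + x / sqrt q + sqrt q * N + (real N)\<^sup>2) \<le> 2 * (u\<^sup>2 + v\<^sup>2)"
  proof -
    have Q0: "Q \<noteq> 0" using Q by simp
    have a: "real q * sqrt (x * q) = u\<^sup>2"
      by (simp add: real_sqrt_mult sq u_def Q(2)[symmetric] eval_nat_numeral mult_ac)
    have b: "real q * (x / sqrt q) = v\<^sup>2"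
    proof -
      have "real q * (x / sqrt q) = Q ^ 4 * (X ^ 4 / Q\<^sup>2)" by (simp only: sq Q(2) X(2))
      then show ?thesis using Q0 by (simp add: v_def eval_nat_numeral mult_ac)
    qed
    have "real q * (sqrt q * N) \<le> real q * (Q\<^sup>2 * (X\<^sup>2 / Q))"
      unfolding sq using Ny by (intro mult_left_mono) auto
    also have "\<dots> = X\<^sup>2 * Q ^ 5" using Q0 by (simp add: Q(2)[symmetric] eval_nat_numeral mult_ac)
    also have "\<dots> \<le> X\<^sup>2 * Q ^ 6" using Q by (intro mult_left_mono power_increasing) auto
    also have "\<dots> = u\<^sup>2" by (simp add: u_def eval_nat_numeral mult_ac)
    finally have c: "real q * (sqrt q * N) \<le> u\<^sup>2" .
    have "real q * (real N)\<^sup>2 \<le> real q * (X\<^sup>2 / Q)\<^sup>2"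
      using Ny by (intro mult_left_mono power_mono) auto
    also have "\<dots> = v\<^sup>2" using Q0 by (simp add: v_def Q(2)[symmetric] eval_nat_numeral mult_ac)
    finally have d: "real q * (real N)\<^sup>2 \<le> v\<^sup>2" .
    have "real q * (sqrt (x * q) + x / sqrt q + sqrt q * N + (real N)\<^sup>2) \<le> u\<^sup>2 + v\<^sup>2 + u\<^sup>2 + v\<^sup>2"
      unfolding distrib_left by (intro add_mono eq_refl a b c d)
    also have "\<dots> = 2 * (u\<^sup>2 + v\<^sup>2)" by simp
    finally show ?thesis .
  qed
  define A where "A = (real L)\<^sup>2 * T\<^sup>2"
  have A1: "A \<ge> 1"
    using L T(1) mult_mono[of 1 "(real L)\<^sup>2" 1 "T\<^sup>2"] by (simp add: A_def one_le_power)
  have "(\<Sum>a\<in>totatives q. \<bar>F a\<bar>)\<^sup>2 \<le> (\<Sum>a\<in>totatives q. \<bar>F a\<bar>\<^sup>2) * real (card (totatives q))"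
    by (rule sum_squared_le_sum_of_squares)
  also have "\<dots> \<le> V * real q"
  proof (rule mult_mono)
    show "(\<Sum>a\<in>totatives q. \<bar>F a\<bar>\<^sup>2) \<le> V"
      unfolding V_def power2_abs by (intro sum_mono2) (auto simp: in_totatives_iff)
    show "real (card (totatives q)) \<le> real q" using totient_le[of q] by (simp add: totient_def)
  qed (auto simp: V_def intro: sum_nonneg)
  also have "\<dots> \<le> (129 * real L ^ 4 * T ^ 4 * (sqrt (x * q) + x / sqrt q + sqrt q * N + (real N)\<^sup>2)) * real q"
    using VG by (intro mult_right_mono) auto
  also have "\<dots> = 129 * A\<^sup>2 * (real q * (sqrt (x * q) + x / sqrt q + sqrt q * N + (real N)\<^sup>2))"
    by (simp add: A_def power_mult_distrib flip: power_mult)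
  also have "\<dots> \<le> 129 * A\<^sup>2 * (2 * (u\<^sup>2 + v\<^sup>2))" using G by (intro mult_left_mono) auto
  also have "\<dots> \<le> 129 * A\<^sup>2 * (2 * (u + v)\<^sup>2)"
    using uv by (intro mult_left_mono) (auto simp: power2_sum)
  \<comment> \<open>\<open>129 * 2 = 258 \<le> 24\<^sup>2\<close>; the term \<open>4 * v\<close>
    from the tails raises 24 to 28.\<close>
  also have "\<dots> \<le> (24 * A * (u + v))\<^sup>2"
    by (simp add: power_mult_distrib mult_right_mono)
  finally have "(\<Sum>a\<in>totatives q. \<bar>F a\<bar>) \<le> 24 * A * (u + v)"
    by (rule power2_le_imp_le) (use A1 uv in auto)
  moreover have "4 * v \<le> 4 * (A * (u + v))"
  proof -
    have "1 * (u + v) \<le> A * (u + v)" using A1 uv by (intro mult_right_mono) auto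
    then show ?thesis using uv by simp
  qed
  ultimately have "(\<Sum>a\<in>totatives q. \<bar>sqfree_error x q a\<bar>) \<le> 28 * A * (u + v)"
    using 1 2 by linarith
  then show ?thesis unfolding A_def u_def v_def pw X_def[symmetric] Q_def[symmetric] by (simp add: mult_ac)
qed

theorem corollary5:
  fixes \<epsilon> :: real
  assumes "\<epsilon> > 0"
  shows "\<exists>C > 0. \<forall>x :: real. \<forall>q :: nat. x \<ge> 1 \<longrightarrow> q \<ge> 1 \<longrightarrow> real q \<le> x \<longrightarrow>
    (\<Sum>a \<in> totatives q. \<bar>sqfree_error x q a\<bar>)
      \<le> C * (x powr \<epsilon> * (x powr (1 / 4) * real q powr (3 / 4) + x powr (1 / 2) * real q powr (1 / 4)))"
proof -
  \<comment> \<open>\<open>L\<^sup>2\<close> and \<open>T\<^sup>2\<close> will each cost a constant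
    times \<open>z\<^sup>2\<close> with \<open>z = x powr (2 * \<delta>)\<close>, together
    \<open>z ^ 4 = x powr (8 * \<delta>)\<close>.\<close>
  define \<delta> where "\<delta> = \<epsilon> / 8"
  have \<delta>: "\<delta> > 0" using assms by (simp add: \<delta>_def)
  obtain K where K: "K \<ge> 1" "\<And>n::nat. n > 0 \<Longrightarrow> real (card {d. d dvd n}) \<le> K * real n powr \<delta>"
    using card_divisors_le_powr[OF \<delta>] by blast
  \<comment> \<open>\<open>B\<close> stems from \<open>ln x \<le> z / (2 * \<delta>)\<close>, which
    bounds \<open>L\<close> by \<open>B * z\<close>. The \<open>4 powr \<delta>\<close> in
    \<open>K'\<close> stems from applying the divisor bound up to
    \<open>4 * x\<^sup>2\<close>.\<close>
  define B where "B = 1 / (2 * \<delta> * ln 2) + 2"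
  define K' where "K' = K * 4 powr \<delta>"
  have B: "B > 0" using \<delta> by (simp add: B_def add_pos_pos)
  have K': "K' \<ge> 1" unfolding K'_def using K(1) \<delta> mult_mono[of 1 K 1 "4 powr \<delta>"]
    by (simp add: ge_one_powr_ge_zero)
  have bound: "(\<Sum>a \<in> totatives q. \<bar>sqfree_error x q a\<bar>)
      \<le> (28 * B\<^sup>2 * K'\<^sup>2) * (x powr \<epsilon> * (x powr (1 / 4) * real q powr (3 / 4) + x powr (1 / 2) * real q powr (1 / 4)))"
    if x: "x \<ge> 1" and q: "q \<ge> 1" "real q \<le> x" for x :: real and q :: nat
  proof -
    define z where "z = x powr (2 * \<delta>)"
    have z1: "z \<ge> 1" using x \<delta> by (simp add: z_def ge_one_powr_ge_zero)
    have z4: "z ^ 4 = x powr \<epsilon>"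
      using x by (simp add: z_def \<delta>_def powr_powr flip: powr_realpow)
    \<comment> \<open>\<open>L\<close> is the number of binary digits of the integer part of
      \<open>x\<close>, so \<open>x < 2 ^ L\<close>.\<close>
    define L where "L = nat \<lfloor>log 2 x\<rfloor> + 1"
    define T where "T = K' * z"
    define W where "W = x powr (1 / 4) * real q powr (3 / 4) + x powr (1 / 2) * real q powr (1 / 4)"
    have log0: "log 2 x \<ge> 0" using x by simp
    have "log 2 x < real L" unfolding L_def using log0 by linarith
    then have xL: "x < 2 ^ L" using x by (simp add: log_less_iff powr_realpow)
    have LB: "real L \<le> B * z"
    proof -
      have "real L \<le> log 2 x + 1" unfolding L_def using log0 by linarith
      also have "log 2 x = ln x / ln 2" by (simp add: log_def)
      also have "ln x \<le> z / (2 * \<delta>)" unfolding z_def using x \<delta> by (intro ln_powr_bound) auto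
      finally have "real L \<le> z / (2 * \<delta>) / ln 2 + 1" by (simp add: divide_right_mono)
      also have "\<dots> \<le> B * z" using z1 by (simp add: B_def algebra_simps)
      finally show ?thesis .
    qed
    have T1: "T \<ge> 1" using K' z1 mult_mono[of 1 K' 1 z] by (simp add: T_def)
    have W0: "W \<ge> 0" by (simp add: W_def)
    have "(\<Sum>a \<in> totatives q. \<bar>sqfree_error x q a\<bar>) \<le> 28 * (real L)\<^sup>2 * T\<^sup>2 * W"
      unfolding W_def
    proof (rule sum_abs_sqfree_error_bound)
      fix n :: nat assume n: "1 \<le> n" "real n \<le> 4 * x\<^sup>2"
      have "real (card {d. d dvd n}) \<le> K * real n powr \<delta>" using n by (intro K(2)) simp
      also have "\<dots> \<le> K * (4 * x\<^sup>2) powr \<delta>"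
        using n K(1) \<delta> by (intro mult_left_mono powr_mono2) auto
      also have "(4 * x\<^sup>2) powr \<delta> = 4 powr \<delta> * z"
      proof -
        have "x\<^sup>2 = x powr 2" using x by simp
        then have "(x\<^sup>2) powr \<delta> = z" by (simp only: powr_powr z_def)
        then show ?thesis by (simp add: powr_mult)
      qed
      finally show "real (card {d. d dvd n}) \<le> T" by (simp add: T_def K'_def mult_ac)
    qed (use x q xL T1 in \<open>auto simp: L_def\<close>)
    also have "\<dots> \<le> 28 * (B * z)\<^sup>2 * T\<^sup>2 * W"
      using LB W0 by (intro mult_right_mono mult_left_mono power_mono) auto
    also have "\<dots> = (28 * B\<^sup>2 * K'\<^sup>2) * (z ^ 4 * W)"
      by (simp add: T_def power_mult_distrib eval_nat_numeral mult_ac)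
    finally show ?thesis unfolding z4 W_def .
  qed
  show ?thesis
    by (rule exI[of _ "28 * B\<^sup>2 * K'\<^sup>2"]) (use bound B K' in auto)
qed

end
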